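(* The following holds for the set $H(3,\mathbb{Z})$ of hyperbolic matrices. (1) There are no matrices in $H(3,\mathbb{Z})$ with norm less than $5$. (2) There are exactly $48$ matrices in $H(3,\mathbb{Z})$ with norm equal to $5$, and for each of them the two-dimensional continued fraction constructed by the matrix is equivalent to the two-dimensional continued fraction constructed by $M_{-1,2,1}$. (3) There are exactly $912$ matrices in $H(3,\mathbb{Z})$ with norm equal to $6$. For each of them the two-dimensional continued fraction constructed by the matrix is equivalent to the one constructed by $M_{-1,2,1}$ (this holds for exactly $480$ of the matrices), or to the one constructed by $M_{-1,3,1}$ (exactly $240$ of the matrices), or to the one constructed by $M_{0,3,1}$ (exactly $192$ of the matrices).
   Context: $M(k,\mathbb{Z})$ denotes the set of $k\times k$ matrices with integer entries whose characteristic polynomial is irreducible over $\mathbb{Q}$. $H(k,\mathbb{Z})\subset M(k,\mathbb{Z})$ is the subset of hyperbolic matrices, meaning those all of whose eigenvalues are real and distinct. The norm of a matrix is the sum of the absolute values of all its entries. For integers $a_1,a_2,a_3$, the Frobenius matrix is $$M_{a_1,a_2,a_3}=\begin{pmatrix} 0 & 1 & 0 \\ 0 & 0 & 1 \\ a_3 & a_2 & a_1 \end{pmatrix}.$$ Multidimensional continued fraction: let $A\in H(k,\mathbb{Z})$. The $k$ hyperplanes in $\mathbb{R}^k$ spanned by the $(k-1)$-element subsets of a basis of eigenvectors of $A$ divide $\mathbb{R}^k$ into $2^k$ open cones (orthants). The sail of an orthant is the boundary of the convex hull of all points of $\mathbb{Z}^k\setminus\{0\}$ lying in that orthant. The set of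 all $2^k$ sails is the $(k-1)$-dimensional continued fraction constructed by $A$. Two $(k-1)$-dimensional continued fractions are equivalent if there is a linear transformation of $\mathbb{R}^k$ preserving the integer lattice $\mathbb{Z}^k$ (mapping it onto itself) that maps one continued fraction to the other.
   Formalization: The counts 240 and 192 in (3) are interchanged: exactly 192 of the 912 matrices give continued fractions equivalent to that of M_{-1,3,1} and exactly 240 to that of M_{0,3,1}; the statement as printed is false. *)

theory Defs
  imports "HOL-Analysis.Analysis" "HOL-Computational_Algebra.Computational_Algebra"
begin

definition charpoly :: "'a::comm_ring_1 ^ 'n ^ 'n \<Rightarrow> 'a poly" where
  "charpoly A = det (mat [:0, 1:] - map_matrix (\<lambda>a. [:a:]) A)"

definition eigenvector :: "'a::field ^ 'n ^ 'n \<Rightarrow> 'a ^ 'n \<Rightarrow> 'a \<Rightarrow> bool" where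
  "eigenvector A v c \<longleftrightarrow> v \<noteq> 0 \<and> A *v v = c *s v"

definition eigenvalues :: "'a::field ^ 'n ^ 'n \<Rightarrow> 'a set" where
  "eigenvalues A = {c. \<exists>v. eigenvector A v c}"

text \<open>The set \<open>M(k, \<int>)\<close>, with \<open>k = CARD('n)\<close>.\<close>
definition irreducible_matrices :: "(int ^ 'n ^ 'n) set" where
  "irreducible_matrices = {A. irreducible (charpoly (map_matrix rat_of_int A))}"

text \<open>The set \<open>H(k, \<int>)\<close>.  Having as many complex eigenvalues as the size of the matrix
  says that the eigenvalues are pairwise distinct.\<close>
definition hyperbolic_matrices :: "(int ^ 'n ^ 'n) set" where
  "hyperbolic_matrices = {A \<in> irreducible_matrices.
     eigenvalues (map_matrix complex_of_int A) \<subseteq> \<real> \<and>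
     card (eigenvalues (map_matrix complex_of_int A)) = CARD('n)}"

definition matrix_norm :: "int ^ 'n ^ 'n \<Rightarrow> int" where
  "matrix_norm A = (\<Sum>i\<in>UNIV. \<Sum>j\<in>UNIV. \<bar>A $ i $ j\<bar>)"

definition frobenius_matrix :: "int \<Rightarrow> int \<Rightarrow> int \<Rightarrow> int ^ 3 ^ 3" where
  "frobenius_matrix a1 a2 a3 =
     vector [vector [0, 1, 0], vector [0, 0, 1], vector [a3, a2, a1]]"

definition integer_lattice :: "(real ^ 'n) set" where
  "integer_lattice = {x. \<forall>i. x $ i \<in> \<int>}"

definition eigenbasis :: "int ^ 'n ^ 'n \<Rightarrow> (real ^ 'n) set \<Rightarrow> bool" where
  "eigenbasis A B \<longleftrightarrow> independent B \<and> span B = UNIV \<and>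
     (\<forall>v\<in>B. \<exists>c. eigenvector (map_matrix real_of_int A) v c)"

text \<open>For hyperbolic \<open>A\<close> the eigenspaces are lines, so every eigenbasis gives the same
  hyperplanes, and ranging over all of them avoids a choice.\<close>
definition eigen_hyperplanes :: "int ^ 'n ^ 'n \<Rightarrow> (real ^ 'n) set set" where
  "eigen_hyperplanes A =
     {span S | S B. eigenbasis A B \<and> S \<subseteq> B \<and> card S = CARD('n) - 1}"

definition orthants :: "int ^ 'n ^ 'n \<Rightarrow> (real ^ 'n) set set" where
  "orthants A = components (- \<Union> (eigen_hyperplanes A))"

definition sail :: "(real ^ 'n) set \<Rightarrow> (real ^ 'n) set" where
  "sail C = frontier (convex hull ((integer_lattice - {0}) \<inter> C))"

definition continued_fraction :: "int ^ 'n ^ 'n \<Rightarrow> (real ^ 'n) set set" where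
  "continued_fraction A = sail ` orthants A"

definition cf_equivalent :: "(real ^ 'n) set set \<Rightarrow> (real ^ 'n) set set \<Rightarrow> bool" where
  "cf_equivalent F G \<longleftrightarrow>
     (\<exists>g. linear g \<and> g ` integer_lattice = integer_lattice \<and> (\<lambda>S. g ` S) ` F = G)"

text \<open>The source attributes the count 240 to \<open>M\<^bsub>-1,3,1\<^esub>\<close> and 192 to \<open>M\<^bsub>0,3,1\<^esub>\<close>, which
  interchanges the two numbers; the theorem has them the right way round.  Equivalent continued
  fractions come from matrices generating isomorphic cubic fields, so the discriminants of their
  characteristic polynomials agree up to rational squares.  Of the 912 hyperbolic matrices of
  size 3 and norm 6, 480 have discriminant 49, 240 have 81 and 192 have 148.  The discriminants
  for \<open>M\<^bsub>-1,2,1\<^esub>\<close>, \<open>M\<^bsub>0,3,1\<^esub>\<close> and \<open>M\<^bsub>-1,3,1\<^esub>\<close> are 49, 81 and 148; only the last is not a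
  square, so exactly 192 matrices can belong to \<open>M\<^bsub>-1,3,1\<^esub>\<close>.\<close>

end

theory Submission
  imports Defs
begin

text \<open>
  Irreducibility forbids a row or a column whose off-diagonal entries all vanish, which leaves about
  fourteen thousand candidates of norm at most 6. A candidate is hyperbolic if and only if its
  characteristic cubic has positive discriminant and no integer root; evaluation leaves 14 cubics,
  with discriminants 49, 81 and 148, and for every surviving \<open>A\<close> some unit row vector \<open>e\<close> makes
  \<open>e\<close>, \<open>eA\<close>, \<open>eA\<^sup>2\<close> a basis of the integer lattice. Hence \<open>A\<close> is conjugate over the integers to
  the Frobenius matrix of its characteristic cubic, and matrices which are integer polynomials in
  each other up to integer conjugation have the same eigendirections, so equivalent continued
  fractions.

  Conversely, the closure of an orthant is the closed cone over its sail, so an equivalence maps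
  orthants to orthants and, these being simplicial, extreme rays to extreme rays. If \<open>g\<close> carries the
  eigendirections of a Frobenius matrix \<open>F\<close> to those of \<open>M\<close>, then \<open>g\<^sup>-\<^sup>1Mg\<close> is an integer polynomial
  in \<open>F\<close>, whence the discriminant of \<open>M\<close> is an integer square times that of \<open>F\<close>. This separates
  49, 81 and 148.
\<close>

no_notation fps_nth (infixl "$" 75)

section \<open>The characteristic cubic\<close>

type_synonym row = "int \<times> int \<times> int"

text \<open>Integer tuples can be enumerated and evaluated; \<open>mat3\<close> leads back to the
  matrices of the theorem.\<close>

definition mat3 :: "row \<times> row \<times> row \<Rightarrow> int ^ 3 ^ 3" where
  "mat3 = (\<lambda>((x, b, c), (d, y, e), (f, g, z)).
     vector [vector [x, b, c], vector [d, y, e], vector [f, g, z]])"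

text \<open>Trace, sum of the principal 2-minors and determinant: the characteristic polynomial is
  x^3 - t x^2 + s x - d.\<close>

fun char_coeffs :: "row \<times> row \<times> row \<Rightarrow> int \<times> int \<times> int" where
  "char_coeffs ((x, b, c), (d, y, e), (f, g, z)) =
     (x + y + z,
      x * y + x * z + y * z - b * d - c * f - e * g,
      x * (y * z - e * g) + b * (e * f - d * z) + c * (d * g - y * f))"

text \<open>The discriminant of x^3 - t x^2 + s x - d. It is polymorphic so that integer
  discriminants can be compared with products of real or complex root differences.\<close>

fun cubic_disc :: "'a::comm_ring_1 \<times> 'a \<times> 'a \<Rightarrow> 'a" where
  "cubic_disc (t, s, d) =
     t^2 * s^2 - 4 * s^3 - 4 * t^3 * d + 18 * t * s * d - 27 * d^2"

declare char_coeffs.simps [simp del] cubic_disc.simps [simp del]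

lemma mat3_eqI:
  fixes A :: "int ^ 3 ^ 3"
  shows "A = mat3 ((A$1$1, A$1$2, A$1$3), (A$2$1, A$2$2, A$2$3), (A$3$1, A$3$2, A$3$3))"
  by (simp add: mat3_def vec_eq_iff forall_3)

lemma bij_mat3: "bij mat3"
proof (rule bijI)
  show "inj mat3"
    by (auto simp: inj_def mat3_def vec_eq_iff forall_3)
  show "surj mat3"
    unfolding surj_def using mat3_eqI by blast
qed

lemma charpoly_mat3:
  assumes "char_coeffs T = (t, s, d)"
  shows "charpoly (map_matrix (of_int :: int \<Rightarrow> 'a::comm_ring_1) (mat3 T))
    = [:- of_int d, of_int s, - of_int t, 1:]"
proof -
  obtain x b c d' y e f g z where T: "T = ((x, b, c), (d', y, e), (f, g, z))"
    by (metis prod.exhaust)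
  have tsd: "t = x + y + z" "s = x * y + x * z + y * z - b * d' - c * f - e * g"
    "d = x * (y * z - e * g) + b * (e * f - d' * z) + c * (d' * g - y * f)"
    using assms by (simp_all add: T char_coeffs.simps)
  show ?thesis
    unfolding T tsd
    by (simp add: charpoly_def det_3 mat3_def map_matrix_def mat_def
      algebra_simps)
qed

lemma poly_charpoly: "poly (charpoly A) x = det (mat x - A)"
  for A :: "'a::comm_ring_1 ^ 'n ^ 'n"
  by (simp add: charpoly_def det_def poly_sum poly_prod map_matrix_def mat_def
    sign_def if_distrib[of "\<lambda>p. poly p x"] cong: if_cong)

lemma eigenvalues_eq_roots:
  fixes A :: "'a::field ^ 'n ^ 'n"
  shows "eigenvalues A = {x. poly (charpoly A) x = 0}"
proof -
  have "x \<in> eigenvalues A \<longleftrightarrow> poly (charpoly A) x = 0" for x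
  proof -
    have "A *v v = x *s v \<longleftrightarrow> (mat x - A) *v v = 0" for v
    proof -
      have "mat x *v v = x *s v"
        by (simp add: vec_eq_iff matrix_vector_mult_def mat_def if_distrib[of "\<lambda>a. a * _"] cong: if_cong)
      then show ?thesis
        by (auto simp: matrix_vector_mult_diff_rdistrib)
    qed
    then have "x \<in> eigenvalues A \<longleftrightarrow> (\<exists>v. v \<noteq> 0 \<and> (mat x - A) *v v = 0)"
      by (simp add: eigenvalues_def eigenvector_def)
    also have "\<dots> \<longleftrightarrow> \<not> invertible (mat x - A)"
      using matrix_left_invertible_ker[of "mat x - A"]
      by (metis invertible_left_inverse)
    finally show ?thesis
      by (simp add: poly_charpoly invertible_det_nz)
  qed
  then show ?thesis by auto
qed

section \<open>Roots, irreducibility and discriminant of a cubic\<close>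

text \<open>A proper factorization of a cubic contains a linear factor, and over a field a linear
  factor has a root.\<close>

lemma cubic_irreducible_iff:
  fixes p :: "'a::field poly"
  assumes "degree p = 3"
  shows "irreducible p \<longleftrightarrow> (\<forall>x. poly p x \<noteq> 0)"
proof
  assume irr: "irreducible p"
  show "\<forall>x. poly p x \<noteq> 0"
  proof (intro allI notI)
    fix x assume "poly p x = 0"
    then obtain q where q: "p = [:-x, 1:] * q"
      by (auto simp: poly_eq_0_iff_dvd)
    have "q \<noteq> 0" using q assms by auto
    then have "degree q = 2"
      using assms degree_mult_eq[of "[:-x, 1:]" q] by (simp add: q del: mult_pCons_left)
    moreover have "is_unit [:-x, 1:] \<or> is_unit q"
      using irr q irreducibleD by blast
    ultimately show False
      by (auto simp: is_unit_iff_degree[OF \<open>q \<noteq> 0\<close>] is_unit_pCons_iff)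
  qed
next
  assume nr: "\<forall>x. poly p x \<noteq> 0"
  have lin: False if "p = a * b" "degree a = 1" for a b
  proof -
    obtain u v where a: "a = [:u, v:]" "v \<noteq> 0"
      using \<open>degree a = 1\<close>
      by (cases a rule: pCons_cases) (auto split: if_splits elim: degree_eq_zeroE)
    then have "poly p (- u / v) = 0"
      using that by simp
    with nr show False by blast
  qed
  show "irreducible p"
  proof (rule irreducibleI)
    show "p \<noteq> 0" using assms by auto
    show "\<not> is_unit p"
      using assms \<open>p \<noteq> 0\<close> by (simp add: is_unit_iff_degree)
    fix a b assume ab: "p = a * b"
    then have nz: "a \<noteq> 0" "b \<noteq> 0" using \<open>p \<noteq> 0\<close> by auto
    then have "degree a + degree b = 3"
      using assms ab by (simp add: degree_mult_eq)
    moreover have "degree a \<noteq> 1" "degree b \<noteq> 1"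
      using lin[OF ab] lin[of b a] ab by (auto simp: mult.commute)
    ultimately have "degree a = 0 \<or> degree b = 0" by linarith
    then show "is_unit a \<or> is_unit b"
      using nz by (simp add: is_unit_iff_degree)
  qed
qed

text \<open>The rational root theorem: clearing denominators in a root a/b in lowest terms makes b
  divide a^3, so b is a unit.\<close>

lemma monic_cubic_rat_root_is_int:
  fixes t s d :: int and x :: rat
  assumes "poly [:- of_int d, of_int s, - of_int t, 1:] x = 0"
  obtains k :: int where "x = of_int k" "k^3 - t * k^2 + s * k - d = 0"
proof -
  obtain a b where x: "x = of_int a / of_int b" and b: "b > 0" and cop: "coprime a b"
    by (metis Fract_of_int_quotient Rat_cases)
  have "x^3 - of_int t * x^2 + of_int s * x - of_int d = 0"
    using assms by (simp add: algebra_simps power3_eq_cube power2_eq_square)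
  then have "of_int (a^3 - t * a^2 * b + s * a * b^2 - d * b^3) = (0::rat)"
    using b by (simp add: x field_simps power3_eq_cube power2_eq_square)
  then have eq: "a^3 - t * a^2 * b + s * a * b^2 - d * b^3 = 0"
    by (simp only: of_int_eq_0_iff)
  then have "a^3 = b * (t * a^2 - s * a * b + d * b^2)"
    by (simp add: algebra_simps power3_eq_cube power2_eq_square)
  then have "b dvd a^3" by simp
  moreover have "coprime b (a^3)"
    using cop by (simp add: coprime_commute)
  ultimately have "is_unit b"
    using coprime_common_divisor[of b "a^3" b] by simp
  then have "b = 1" using b by simp
  then show thesis
    using that[of a] x eq by simp
qed

text \<open>Subtracting the equations of two roots and cancelling their difference lowers the
  degree; doing this twice isolates the sum of the roots.\<close>

lemma cubic_Vieta:
  fixes a b c t s d :: "'a::idom"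
  assumes "distinct [a, b, c]"
    and "\<And>x. x \<in> {a, b, c} \<Longrightarrow> x^3 - t * x^2 + s * x - d = 0"
  shows "t = a + b + c" "s = a * b + a * c + b * c" "d = a * b * c"
proof -
  have A: "a^3 - t * a^2 + s * a - d = 0" and B: "b^3 - t * b^2 + s * b - d = 0"
    and C: "c^3 - t * c^2 + s * c - d = 0"
    using assms(2) by auto
  have "(a - b) * (a^2 + a * b + b^2 - t * (a + b) + s) = 0"
    using A B by algebra
  then have AB: "a^2 + a * b + b^2 - t * (a + b) + s = 0" using assms(1) by auto
  have "(a - c) * (a^2 + a * c + c^2 - t * (a + c) + s) = 0"
    using A C by algebra
  then have AC: "a^2 + a * c + c^2 - t * (a + c) + s = 0" using assms(1) by auto
  have "(b - c) * (a + b + c - t) = 0" using AB AC by algebra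
  then show t: "t = a + b + c" using assms(1) by auto
  show s: "s = a * b + a * c + b * c" using AB t by algebra
  show "d = a * b * c" using A t s by algebra
qed

lemma cubic_disc_roots:
  "cubic_disc (a + b + c, a * b + a * c + b * c, a * b * c)
    = ((a - b) * (a - c) * (b - c))^2"
  unfolding cubic_disc.simps by (simp add: algebra_simps power2_eq_square power3_eq_cube)

text \<open>The intermediate value theorem gives one root \<open>a\<close>; the discriminant then
  shows that the quadratic cofactor has two further real roots, both different from
  \<open>a\<close>.\<close>

lemma cubic_three_real_roots:
  fixes t s d :: real
  assumes "cubic_disc (t, s, d) > 0"
  obtains a b c where "distinct [a, b, c]"
    "t = a + b + c" "s = a * b + a * c + b * c" "d = a * b * c"
proof -
  have "\<exists>a. a^3 - t * a^2 + s * a - d = 0"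
  proof -
    \<comment> \<open>At \<open>m\<close> and at \<open>-m\<close> the cubic term outweighs all the
      others, so the cubic changes sign in between.\<close>
    define m where "m = 1 + \<bar>t\<bar> + \<bar>s\<bar> + \<bar>d\<bar>"
    have m: "m \<ge> 1" "\<bar>t\<bar> + \<bar>s\<bar> + \<bar>d\<bar> < m" by (simp_all add: m_def)
    have small: "\<bar>t * x^2 - s * x + d\<bar> < m^3" if "\<bar>x\<bar> = m" for x
    proof -
      have "\<bar>t * x^2 - s * x + d\<bar> \<le> \<bar>t\<bar> * m^2 + \<bar>s\<bar> * m + \<bar>d\<bar>"
        using abs_triangle_ineq4[of "t * x^2" "s * x"] abs_triangle_ineq[of "t * x^2 - s * x" d] that
        by (simp add: abs_mult power_abs)
      also have "\<dots> \<le> \<bar>t\<bar> * m^2 + \<bar>s\<bar> * m^2 + \<bar>d\<bar> * m^2"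
        using m by (intro add_mono mult_left_mono)
          (auto simp: power2_eq_square mult_le_cancel_left1 mult_le_cancel_right1 intro: order_trans)
      also have "\<dots> = (\<bar>t\<bar> + \<bar>s\<bar> + \<bar>d\<bar>) * m^2" by (simp add: algebra_simps)
      also have "\<dots> < m * m^2" using m by (intro mult_strict_right_mono) auto
      finally show ?thesis by (simp add: power3_eq_cube power2_eq_square)
    qed
    have "(-m)^3 - t * (-m)^2 + s * (-m) - d \<le> 0" "0 \<le> m^3 - t * m^2 + s * m - d"
      using small[of m] small[of "-m"] m by (auto simp: abs_less_iff power3_eq_cube power2_eq_square)
    then have "\<exists>x. -m \<le> x \<and> x \<le> m \<and> x^3 - t * x^2 + s * x - d = 0"
      using m by (intro IVT2' IVT' continuous_intros) auto
    then show ?thesis by blast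
  qed
  then obtain a where a: "a^3 - t * a^2 + s * a - d = 0" ..
  \<comment> \<open>The cofactor of x - a is x^2 - u x + w.\<close>
  define u where "u = t - a"
  define w where "w = s - a * u"
  have d: "d = a * w" and t: "t = a + u" and s: "s = w + a * u"
    using a by (simp_all add: u_def w_def algebra_simps power2_eq_square power3_eq_cube)
  \<comment> \<open>The cubic discriminant is the discriminant of the cofactor times the square of
    its value at \<open>a\<close>. Positivity makes the former positive and the latter
    nonzero.\<close>
  have "cubic_disc (t, s, d) = (u^2 - 4 * w) * (a^2 - u * a + w)^2"
    unfolding cubic_disc.simps d t s by (simp add: algebra_simps power2_eq_square power3_eq_cube)
  then have pos: "u^2 - 4 * w > 0" "a^2 - u * a + w \<noteq> 0"
    using assms by (auto simp: zero_less_mult_iff)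
  define r where "r = sqrt (u^2 - 4 * w)"
  have r: "r > 0" "r^2 = u^2 - 4 * w" using pos by (auto simp: r_def)
  define b c where "b = (u + r) / 2" and "c = (u - r) / 2"
  have u: "u = b + c" by (simp add: b_def c_def field_simps)
  have w: "w = b * c" using r by (simp add: b_def c_def power2_eq_square algebra_simps)
  have "(a - b) * (a - c) \<noteq> 0"
    using pos(2) by (simp add: u w algebra_simps power2_eq_square)
  then have "distinct [a, b, c]" using r by (auto simp: b_def c_def)
  then show thesis
    using that[of a b c] by (simp add: t s d u w algebra_simps)
qed

lemma of_int_cubic_disc: "cubic_disc (of_int t, of_int s, of_int d) = of_int (cubic_disc (t, s, d))"
  by (simp add: cubic_disc.simps)

text \<open>A monic integer cubic without integer roots has no rational root, so it is irreducible.
  Its discriminant is the squared product of the root differences, positive exactly when the roots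
  are real and distinct.\<close>

lemma hyperbolic_mat3_iff:
  assumes T: "char_coeffs T = (t, s, d)"
  shows "mat3 T \<in> hyperbolic_matrices \<longleftrightarrow>
    cubic_disc (t, s, d) > 0 \<and> (\<forall>k. k^3 - t * k^2 + s * k - d \<noteq> 0)"
proof -
  have "mat3 T \<in> irreducible_matrices \<longleftrightarrow> (\<forall>k. k^3 - t * k^2 + s * k - d \<noteq> 0)"
  proof -
    let ?p = "[:- of_int d, of_int s, - of_int t, 1:] :: rat poly"
    have "mat3 T \<in> irreducible_matrices \<longleftrightarrow> (\<forall>x. poly ?p x \<noteq> 0)"
      using cubic_irreducible_iff[of ?p] by (simp add: irreducible_matrices_def charpoly_mat3[OF T])
    also have "\<dots> \<longleftrightarrow> (\<forall>k. k^3 - t * k^2 + s * k - d \<noteq> 0)"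
    proof safe
      fix k assume "\<forall>x. poly ?p x \<noteq> 0" "k^3 - t * k^2 + s * k - d = 0"
      then have "of_int (k^3 - t * k^2 + s * k - d) = (0::rat)" by simp
      then have "poly ?p (of_int k) = 0"
        by (simp add: algebra_simps power2_eq_square power3_eq_cube)
      with \<open>\<forall>x. poly ?p x \<noteq> 0\<close> show False by blast
    next
      fix x assume "\<forall>k. k^3 - t * k^2 + s * k - d \<noteq> 0" "poly ?p x = 0"
      then show False by (metis monic_cubic_rat_root_is_int)
    qed
    finally show ?thesis .
  qed
  moreover
  let ?E = "eigenvalues (map_matrix complex_of_int (mat3 T))"
  have E: "x \<in> ?E \<longleftrightarrow> x^3 - of_int t * x^2 + of_int s * x - of_int d = 0" for x
    by (simp add: eigenvalues_eq_roots charpoly_mat3[OF T] algebra_simps power2_eq_square power3_eq_cube)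
  have "?E \<subseteq> \<real> \<and> card ?E = 3 \<longleftrightarrow> cubic_disc (t, s, d) > 0"
  proof
    assume *: "?E \<subseteq> \<real> \<and> card ?E = 3"
    then obtain a b c where abc: "?E = {a, b, c}" "distinct [a, b, c]"
      by (auto simp: card_3_iff)
    then obtain a' b' c' where r: "a = of_real a'" "b = of_real b'" "c = of_real c'"
      using * by (auto elim!: Reals_cases)
    have V: "of_int t = a + b + c" "of_int s = a * b + a * c + b * c" "of_int d = a * b * c"
      using cubic_Vieta[OF abc(2), of "of_int t" "of_int s" "of_int d"] E abc(1) by auto
    have "complex_of_real (of_int (cubic_disc (t, s, d))) = cubic_disc (of_int t, of_int s, of_int d)"
      by (simp add: of_int_cubic_disc)
    also have "\<dots> = ((a - b) * (a - c) * (b - c))^2"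
      by (simp only: V cubic_disc_roots)
    also have "\<dots> = of_real (((a' - b') * (a' - c') * (b' - c'))^2)"
      by (simp add: r)
    finally have "real_of_int (cubic_disc (t, s, d)) = ((a' - b') * (a' - c') * (b' - c'))^2"
      by (simp only: of_real_eq_iff)
    also have "\<dots> > 0" using abc(2) r by auto
    finally show "cubic_disc (t, s, d) > 0" by simp
  next
    assume "cubic_disc (t, s, d) > 0"
    then have "cubic_disc (real_of_int t, real_of_int s, real_of_int d) > 0"
      by (simp add: of_int_cubic_disc)
    then obtain a b c :: real where abc: "distinct [a, b, c]"
      and V: "real_of_int t = a + b + c" "real_of_int s = a * b + a * c + b * c"
        "real_of_int d = a * b * c"
      by (rule cubic_three_real_roots)
    have "complex_of_int t = of_real (real_of_int t)" "complex_of_int s = of_real (real_of_int s)"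
      "complex_of_int d = of_real (real_of_int d)" by simp_all
    then have "x^3 - of_int t * x^2 + of_int s * x - of_int d
      = (x - of_real a) * (x - of_real b) * (x - of_real c)" for x :: complex
      unfolding V by (simp add: algebra_simps power2_eq_square power3_eq_cube)
    then have "?E = {of_real a, of_real b, of_real c}"
      using E by auto
    then show "?E \<subseteq> \<real> \<and> card ?E = 3"
      using abc by auto
  qed
  ultimately show ?thesis
    by (auto simp: hyperbolic_matrices_def)
qed

lemma int_root_dvd:
  fixes k t s d :: int
  assumes "k^3 - t * k^2 + s * k - d = 0"
  shows "k dvd d"
proof
  show "d = k * (k^2 - t * k + s)"
    using assms by (simp add: algebra_simps power2_eq_square power3_eq_cube)
qed

text \<open>An integer root divides the constant term, so searching between -|d| and |d| decides
  whether one exists.\<close>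

fun hyperbolic_coeffs :: "int \<times> int \<times> int \<Rightarrow> bool" where
  "hyperbolic_coeffs (t, s, d) \<longleftrightarrow> cubic_disc (t, s, d) > 0 \<and>
     list_all (\<lambda>k. k^3 - t * k^2 + s * k - d \<noteq> 0) [-\<bar>d\<bar>..\<bar>d\<bar>]"

declare hyperbolic_coeffs.simps [simp del]

lemma hyperbolic_mat3: "mat3 T \<in> hyperbolic_matrices \<longleftrightarrow> hyperbolic_coeffs (char_coeffs T)"
proof -
  obtain t s d where T: "char_coeffs T = (t, s, d)" by (metis prod.exhaust)
  have "(\<forall>k. k^3 - t * k^2 + s * k - d \<noteq> 0) \<longleftrightarrow>
    (\<forall>k\<in>{-\<bar>d\<bar>..\<bar>d\<bar>}. k^3 - t * k^2 + s * k - d \<noteq> 0)" (is "?L \<longleftrightarrow> ?R")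
  proof
    assume R: ?R
    show ?L
    proof (intro allI notI)
      fix k assume k: "k^3 - t * k^2 + s * k - d = 0"
      show False
      proof (cases "d = 0")
        \<comment> \<open>For a vanishing constant term, 0 is a root, and the search range is just
          0.\<close>
        case True
        then show False using R by simp
      next
        case False
        then have "\<bar>k\<bar> \<le> \<bar>d\<bar>" using int_root_dvd[OF k] by (simp add: dvd_imp_le_int)
        then show False using R k by (auto simp: abs_le_iff)
      qed
    qed
  qed blast
  then show ?thesis
    by (simp add: hyperbolic_mat3_iff[OF T] hyperbolic_coeffs.simps T list_all_iff)
qed

text \<open>If the off-diagonal entries of a row or column vanish, its diagonal entry is an
  eigenvalue, hence an integer root.\<close>

lemma hyperbolic_mat3_off_diagonal:
  assumes "hyperbolic_coeffs (char_coeffs ((x, b, c), (d, y, e), (f, g, z)))"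
  shows "b \<noteq> 0 \<or> c \<noteq> 0" "d \<noteq> 0 \<or> e \<noteq> 0" "f \<noteq> 0 \<or> g \<noteq> 0"
    "d \<noteq> 0 \<or> f \<noteq> 0" "b \<noteq> 0 \<or> g \<noteq> 0" "c \<noteq> 0 \<or> e \<noteq> 0"
proof -
  let ?T = "((x, b, c), (d, y, e), (f, g, z))"
  obtain t s D where T: "char_coeffs ?T = (t, s, D)" by (metis prod.exhaust)
  then have tsd: "t = x + y + z" "s = x * y + x * z + y * z - b * d - c * f - e * g"
    "D = x * (y * z - e * g) + b * (e * f - d * z) + c * (d * g - y * f)"
    by (simp_all add: char_coeffs.simps)
  have "\<forall>k. k^3 - t * k^2 + s * k - D \<noteq> 0"
    using assms hyperbolic_mat3 hyperbolic_mat3_iff[OF T] by blast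
  then have "x^3 - t * x^2 + s * x - D \<noteq> 0" "y^3 - t * y^2 + s * y - D \<noteq> 0"
    "z^3 - t * z^2 + s * z - D \<noteq> 0"
    by blast+
  \<comment> \<open>Up to sign these are the values of the characteristic cubic at the three
    diagonal entries; every summand contains a factor from each row and each column
    concerned.\<close>
  then have "b * d * (x - z) + c * f * (x - y) + b * e * f + c * d * g \<noteq> 0"
    "b * d * (y - z) + e * g * (y - x) + b * e * f + c * d * g \<noteq> 0"
    "c * f * (z - y) + e * g * (z - x) + b * e * f + c * d * g \<noteq> 0"
    by (simp_all add: tsd algebra_simps power2_eq_square power3_eq_cube)
  then show "b \<noteq> 0 \<or> c \<noteq> 0" "d \<noteq> 0 \<or> e \<noteq> 0" "f \<noteq> 0 \<or> g \<noteq> 0"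
    "d \<noteq> 0 \<or> f \<noteq> 0" "b \<noteq> 0 \<or> g \<noteq> 0" "c \<noteq> 0 \<or> e \<noteq> 0"
    by auto
qed

section \<open>Enumeration of the hyperbolic matrices of a given norm\<close>

fun row_norm :: "row \<Rightarrow> int" where
  "row_norm (x, b, c) = \<bar>x\<bar> + \<bar>b\<bar> + \<bar>c\<bar>"

text \<open>A row is listed with its diagonal entry first.\<close>

definition rows_of_norm :: "int \<Rightarrow> row list" where
  "rows_of_norm w = concat (map (\<lambda>x. concat (map (\<lambda>b.
     let m = w - \<bar>x\<bar> - \<bar>b\<bar>
     in if m = 0 then if b = 0 then [] else [(x, b, 0)] else [(x, b, - m), (x, b, m)])
     [- (w - \<bar>x\<bar>)..w - \<bar>x\<bar>])) [-w..w])"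

text \<open>Hyperbolicity is tested entry by entry, not by filtering the final list, because rewriting
  long lists takes quadratic time.\<close>

fun entries :: "row \<Rightarrow> row \<Rightarrow> row \<Rightarrow> (row \<times> row \<times> row) list" where
  "entries (x, b, c) (y, d, e) (z, f, g) =
     (if (d = 0 \<and> f = 0) \<or> (b = 0 \<and> g = 0) \<or> (c = 0 \<and> e = 0) then []
      else if hyperbolic_coeffs (char_coeffs ((x, b, c), (d, y, e), (f, g, z)))
      then [((x, b, c), (d, y, e), (f, g, z))] else [])"

definition extend :: "row list \<Rightarrow> row \<Rightarrow> row \<Rightarrow> (row \<times> row \<times> row) list" where
  "extend R r1 r2 = concat (map (entries r1 r2) R)"

definition assemble :: "row list \<Rightarrow> row list \<Rightarrow> row list \<Rightarrow> (row \<times> row \<times> row) list" where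
  "assemble R1 R2 R3 = concat (map (\<lambda>r1. concat (map (extend R3 r1) R2)) R1)"

text \<open>Each row needs a nonzero off-diagonal entry, so row norms start at 1; the first two
  ranges leave at least 1 for the third row.\<close>

definition hyperbolic_list :: "int \<Rightarrow> (row \<times> row \<times> row) list" where
  "hyperbolic_list n = concat (map (\<lambda>w1. concat (map (\<lambda>w2.
     assemble (rows_of_norm w1) (rows_of_norm w2) (rows_of_norm (n - w1 - w2)))
     [1..n - w1 - 1])) [1..n - 2])"

text \<open>Matrices are counted by list length, so repetitions must be excluded. Here every element
  determines the index it came from.\<close>

lemma distinct_concat_map:
  assumes "distinct xs" "\<And>x. x \<in> set xs \<Longrightarrow> distinct (f x)"
    and "\<And>x y z. z \<in> set (f x) \<Longrightarrow> z \<in> set (f y) \<Longrightarrow> x = y"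
  shows "distinct (concat (map f xs))"
  using assms(1,2)
proof (induction xs)
  case (Cons a xs)
  have "set (f a) \<inter> set (concat (map f xs)) = {}"
  proof (rule equals0I)
    fix z assume "z \<in> set (f a) \<inter> set (concat (map f xs))"
    then obtain y where "y \<in> set xs" "z \<in> set (f y)" "z \<in> set (f a)" by auto
    then show False using assms(3)[of z a y] Cons.prems(1) by simp
  qed
  then show ?case using Cons by simp
qed simp

lemma concat_mapI: "x \<in> set xs \<Longrightarrow> z \<in> set (f x) \<Longrightarrow> z \<in> set (concat (map f xs))"
  by auto

lemma set_rows: "set (rows_of_norm w) = {(x, b, c). row_norm (x, b, c) = w \<and> (b \<noteq> 0 \<or> c \<noteq> 0)}"
proof (intro set_eqI iffI)
  fix r assume "r \<in> set (rows_of_norm w)"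
  then show "r \<in> {(x, b, c). row_norm (x, b, c) = w \<and> (b \<noteq> 0 \<or> c \<noteq> 0)}"
    unfolding rows_of_norm_def Let_def set_concat set_map
    by (elim UnionE imageE) (auto split: if_splits)
next
  fix r assume "r \<in> {(x, b, c). row_norm (x, b, c) = w \<and> (b \<noteq> 0 \<or> c \<noteq> 0)}"
  then obtain x b c where r: "r = (x, b, c)" "w = \<bar>x\<bar> + \<bar>b\<bar> + \<bar>c\<bar>" "b \<noteq> 0 \<or> c \<noteq> 0"
    by auto
  show "r \<in> set (rows_of_norm w)"
    unfolding rows_of_norm_def Let_def
    by (rule concat_mapI[of x], use r in force, rule concat_mapI[of b])
      (use r in \<open>auto simp: abs_if\<close>)
qed

lemma distinct_rows: "distinct (rows_of_norm w)"
  unfolding rows_of_norm_def by (intro distinct_concat_map) (auto simp: Let_def split: if_splits)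

text \<open>The column test merely spares the evaluation of the cubic: hyperbolic matrices pass it
  by \<open>hyperbolic_mat3_off_diagonal\<close>.\<close>

lemma set_entries: "set (entries (x, b, c) (y, d, e) (z, f, g)) =
    {T. T = ((x, b, c), (d, y, e), (f, g, z)) \<and> hyperbolic_coeffs (char_coeffs T)}"
proof -
  let ?T = "((x, b, c), (d, y, e), (f, g, z))"
  have "hyperbolic_coeffs (char_coeffs ?T) \<Longrightarrow>
    \<not> ((d = 0 \<and> f = 0) \<or> (b = 0 \<and> g = 0) \<or> (c = 0 \<and> e = 0))"
    using hyperbolic_mat3_off_diagonal(4-6)[of x b c d y e f g z] by blast
  then show ?thesis by auto
qed

lemma set_assemble: "set (assemble R1 R2 R3) =
    {T. hyperbolic_coeffs (char_coeffs T) \<and>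
      (\<exists>x b c d y e f g z. T = ((x, b, c), (d, y, e), (f, g, z)) \<and>
        (x, b, c) \<in> set R1 \<and> (y, d, e) \<in> set R2 \<and> (z, f, g) \<in> set R3)}"
proof -
  have "T \<in> set (assemble R1 R2 R3) \<longleftrightarrow>
    (\<exists>r1\<in>set R1. \<exists>r2\<in>set R2. \<exists>r3\<in>set R3. T \<in> set (entries r1 r2 r3))" for T
    by (auto simp: assemble_def extend_def)
  then have "T \<in> set (assemble R1 R2 R3) \<longleftrightarrow>
    (\<exists>x b c d y e f g z. (x, b, c) \<in> set R1 \<and> (y, d, e) \<in> set R2 \<and> (z, f, g) \<in> set R3 \<and>
      T \<in> set (entries (x, b, c) (y, d, e) (z, f, g)))" for T
    by (metis prod.exhaust)
  then show ?thesis
    unfolding set_entries by blast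
qed

lemma distinct_assemble:
  assumes "distinct R1" "distinct R2" "distinct R3"
  shows "distinct (assemble R1 R2 R3)"
proof -
  \<comment> \<open>The listed rows, diagonal entry first, can be read off from the assembled
    matrix, so different choices give different matrices.\<close>
  have entries: "r1 = (fst T1, snd T1) \<and> r2 = (fst (snd T2), fst T2, snd (snd T2))
      \<and> r3 = (snd (snd T3), fst T3, fst (snd T3))"
    if "(T1, T2, T3) \<in> set (entries r1 r2 r3)" for T1 T2 T3 r1 r2 r3
    using that by (cases "(r1, r2, r3)" rule: entries.cases) (auto split: if_splits)
  have e: "distinct (entries r1 r2 r3)" for r1 r2 r3
    by (cases "(r1, r2, r3)" rule: entries.cases) auto
  have x: "distinct (extend R3 r1 r2)" for r1 r2
    unfolding extend_def by (rule distinct_concat_map) (auto simp: assms e dest!: entries)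
  have y: "distinct (concat (map (extend R3 r1) R2))" for r1
    by (rule distinct_concat_map) (auto simp: assms x, auto simp: extend_def dest!: entries)
  show ?thesis
    unfolding assemble_def
    by (rule distinct_concat_map) (simp_all only: assms y, auto simp: extend_def dest!: entries)
qed

lemma distinct_hyperbolic_list: "distinct (hyperbolic_list n)"
  unfolding hyperbolic_list_def
proof (rule distinct_concat_map, goal_cases)
  case (2 w1)
  show ?case
    by (rule distinct_concat_map)
      (auto simp: set_assemble set_rows distinct_assemble distinct_rows simp del: row_norm.simps)
qed (auto simp: set_assemble set_rows simp del: row_norm.simps)

lemma matrix_norm_mat3: "matrix_norm (mat3 (r1, r2, r3)) = row_norm r1 + row_norm r2 + row_norm r3"
  by (cases r1; cases r2; cases r3) (simp add: matrix_norm_def mat3_def sum_3)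

lemma hyperbolic_of_norm:
  "{A \<in> hyperbolic_matrices. matrix_norm A = n} = mat3 ` set (hyperbolic_list n)"
proof (intro set_eqI iffI)
  fix A :: "int ^ 3 ^ 3" assume A: "A \<in> {A \<in> hyperbolic_matrices. matrix_norm A = n}"
  obtain x b c d y e f g z where T: "A = mat3 ((x, b, c), (d, y, e), (f, g, z))"
    using mat3_eqI by blast
  let ?T = "((x, b, c), (d, y, e), (f, g, z))"
  have hyp: "hyperbolic_coeffs (char_coeffs ?T)" using A T hyperbolic_mat3 by blast
  note nz = hyperbolic_mat3_off_diagonal[OF hyp]
  have n: "n = row_norm (x, b, c) + row_norm (d, y, e) + row_norm (f, g, z)"
    using A by (simp add: T matrix_norm_mat3 del: row_norm.simps)
  have "?T \<in> set (assemble (rows_of_norm (row_norm (x, b, c))) (rows_of_norm (row_norm (d, y, e)))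
      (rows_of_norm (n - row_norm (x, b, c) - row_norm (d, y, e))))"
    unfolding set_assemble set_rows n using nz hyp by auto
  moreover have "row_norm (x, b, c) \<ge> 1" "row_norm (d, y, e) \<ge> 1" "row_norm (f, g, z) \<ge> 1"
    using nz(1-3) by auto
  ultimately have "?T \<in> set (hyperbolic_list n)"
    unfolding hyperbolic_list_def
    by (intro concat_mapI[of "row_norm (x, b, c)"] concat_mapI[of "row_norm (d, y, e)"])
      (auto simp: n simp del: row_norm.simps)
  then show "A \<in> mat3 ` set (hyperbolic_list n)" by (simp add: T)
next
  fix A assume "A \<in> mat3 ` set (hyperbolic_list n)"
  then obtain T w1 w2 where A: "A = mat3 T"
    and "T \<in> set (assemble (rows_of_norm w1) (rows_of_norm w2) (rows_of_norm (n - w1 - w2)))"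
    by (auto simp: hyperbolic_list_def)
  then obtain x b c d y e f g z where T: "T = ((x, b, c), (d, y, e), (f, g, z))"
    and hyp: "hyperbolic_coeffs (char_coeffs T)"
    and "(x, b, c) \<in> set (rows_of_norm w1)" "(y, d, e) \<in> set (rows_of_norm w2)"
      "(z, f, g) \<in> set (rows_of_norm (n - w1 - w2))"
    unfolding set_assemble by blast
  then have "row_norm (x, b, c) + row_norm (d, y, e) + row_norm (f, g, z) = n"
    by (simp add: set_rows)
  then show "A \<in> {A \<in> hyperbolic_matrices. matrix_norm A = n}"
    using hyp by (simp add: A T matrix_norm_mat3 hyperbolic_mat3 del: row_norm.simps)
qed

section \<open>Cyclic vectors, the occurring cubics and the evaluated counts\<close>

text \<open>The three disjuncts are \<open>\<bar>det (e, eA, eA\<^sup>2)\<bar> = 1\<close> for the three unit row vectors \<open>e\<close>.\<close>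

definition cyclic_unit_vector :: "row \<times> row \<times> row \<Rightarrow> bool" where
  "cyclic_unit_vector = (\<lambda>((x, b, c), (d, y, e), (f, g, z)).
     \<bar>b * (b * e + c * (z - y)) - c * c * g\<bar> = 1 \<or>
     \<bar>e * (d * (x - z) + e * f) - d * d * c\<bar> = 1 \<or>
     \<bar>f * (f * b + g * (y - x)) - g * g * d\<bar> = 1)"

text \<open>Triples (t, s, d) as returned by \<open>char_coeffs\<close>; the corresponding Frobenius
  matrix has parameters t, -s, d. The list is closed under (t, s, d) -> (-t, s, -d), the effect of
  negating a matrix.\<close>

definition standard_coeffs :: "(int \<times> int \<times> int) list" where
  "standard_coeffs = [(-3, 0, 1), (-2, -1, 1), (-2, -2, 2), (-1, -2, 1), (-1, -3, 1),
     (0, -3, -1), (0, -3, 1), (1, -2, -1), (0, -4, -2), (0, -4, 2), (1, -3, -1),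
     (2, -2, -2), (2, -1, -1), (3, 0, -1)]"

definition is_standard :: "int \<times> int \<times> int \<Rightarrow> bool" where
  "is_standard p \<longleftrightarrow> p \<in> set standard_coeffs"

text \<open>The counted values are the discriminants of the three target cubics. The last component
  certifies what the classification uses: a cyclic unit vector and a known cubic for each listed
  matrix.\<close>

definition census :: "int \<Rightarrow> nat \<times> nat \<times> nat \<times> nat \<times> bool" where
  "census n = (let L = hyperbolic_list n; Ds = map (cubic_disc \<circ> char_coeffs) L
     in (length L, length (filter ((=) 49) Ds), length (filter ((=) 81) Ds),
         length (filter ((=) 148) Ds),
         list_all cyclic_unit_vector L \<and> list_all (is_standard \<circ> char_coeffs) L))"

lemma census_le_4: "list_all (\<lambda>n. hyperbolic_list n = []) [0..4]"
  by code_simp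

lemma census_5: "census 5 = (48, 48, 0, 0, True)"
  by code_simp

lemma census_6: "census 6 = (912, 480, 240, 192, True)"
  by code_simp

section \<open>Transport of continued fractions\<close>

text \<open>The hyperplanes depend only on the eigenlines, so the eigenvalue is forgotten: different
  matrices may share a continued fraction.\<close>

definition eigendirection :: "int ^ 'n ^ 'n \<Rightarrow> real ^ 'n \<Rightarrow> bool" where
  "eigendirection A v \<longleftrightarrow> (\<exists>c. eigenvector (map_matrix real_of_int A) v c)"

lemma axis_in_integer_lattice: "axis i 1 \<in> integer_lattice"
  by (auto simp: integer_lattice_def axis_def)

lemma span_integer_lattice: "span (integer_lattice :: (real ^ 'n) set) = UNIV"
proof -
  have "Basis \<subseteq> (integer_lattice :: (real ^ 'n) set)"
    by (auto simp: Basis_vec_def axis_in_integer_lattice)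
  then show ?thesis using span_mono span_Basis by blast
qed

text \<open>The lattice spans the space, so a linear map onto the lattice is onto the space, and a
  surjective linear endomorphism is injective.\<close>

lemma bij_of_lattice_automorphism:
  fixes g :: "real ^ 'n \<Rightarrow> real ^ 'n"
  assumes "linear g" "g ` integer_lattice = integer_lattice"
  shows "bij g"
proof -
  have "range g = span (g ` integer_lattice)"
    using linear_span_image[OF assms(1), of integer_lattice] by (simp add: span_integer_lattice)
  then have "surj g" by (simp add: assms(2) span_integer_lattice)
  then show ?thesis
    using assms(1) by (simp add: bij_def linear_surjective_imp_injective)
qed

lemma linear_inv_bij:
  fixes g :: "real ^ 'n \<Rightarrow> real ^ 'n"
  assumes "linear g" "bij g"
  shows "linear (inv g)"
  using assms by (simp add: bij_is_inj inj_linear_imp_inv_linear)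

lemma inv_lattice:
  assumes "bij g" "g ` L = L"
  shows "inv g ` L = L"
  using assms by (metis bij_is_inj image_inv_f_f)

text \<open>A linear bijection and its inverse are continuous, so maximal connected subsets go to
  maximal connected subsets.\<close>

lemma components_linear_image_subset:
  fixes g :: "real ^ 'n \<Rightarrow> real ^ 'n"
  assumes "linear g" "bij g"
  shows "image g ` components S \<subseteq> components (g ` S)"
proof
  fix D assume "D \<in> image g ` components S"
  then obtain C where C: "C \<in> components S" and D: "D = g ` C" by auto
  have C': "C \<noteq> {}" "C \<subseteq> S" "connected C"
    using C by (simp_all add: in_components_nonempty in_components_subset in_components_connected)
  have max: "E = C" if "C \<subseteq> E" "E \<subseteq> S" "connected E" for E
    using components_maximal[OF C] that C'(1) by blast
  have con: "connected (f ` T)" if "connected T" "linear f" for T and f :: "real ^ 'n \<Rightarrow> real ^ 'n"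
    using that by (meson connected_continuous_image linear_continuous_on linear_conv_bounded_linear)
  have "E = D" if E: "D \<subseteq> E" "E \<subseteq> g ` S" "connected E" for E
  proof -
    \<comment> \<open>A connected competitor \<open>E\<close> is pulled back to one of
      \<open>C\<close>, where maximality applies.\<close>
    let ?F = "inv g ` E"
    have gF: "g ` ?F = E" using assms(2) by (simp add: bij_is_surj image_f_inv_f)
    have "connected ?F" using E(3) assms by (intro con linear_inv_bij)
    moreover have "C \<subseteq> ?F" "?F \<subseteq> S"
      using image_mono[OF E(1), of "inv g"] image_mono[OF E(2), of "inv g"] assms(2)
      by (simp_all add: D image_inv_f_f bij_is_inj)
    ultimately have "?F = C" by (intro max)
    then show ?thesis using gF D by simp
  qed
  moreover have "D \<noteq> {}" "D \<subseteq> g ` S" "connected D"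
    using C' D con[OF _ assms(1)] by auto
  ultimately show "D \<in> components (g ` S)"
    unfolding in_components_maximal by blast
qed

lemma components_linear_image:
  fixes g :: "real ^ 'n \<Rightarrow> real ^ 'n"
  assumes "linear g" "bij g"
  shows "components (g ` S) = image g ` components S"
proof
  show "image g ` components S \<subseteq> components (g ` S)"
    using assms by (rule components_linear_image_subset)
  have inv: "inv g ` g ` S = S" for S
    using assms(2) by (simp add: bij_is_inj image_inv_f_f)
  have gi: "g (inv g x) = x" for x
    using assms(2) by (simp add: bij_is_surj surj_f_inv_f)
  have "image (inv g) ` components (g ` S) \<subseteq> components (inv g ` g ` S)"
    using assms by (intro components_linear_image_subset linear_inv_bij bij_imp_bij_inv)
  then have "image g ` image (inv g) ` components (g ` S) \<subseteq> image g ` components S"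
    by (simp add: inv image_mono)
  then show "components (g ` S) \<subseteq> image g ` components S"
    by (simp add: image_image gi)
qed

text \<open>A linear bijection commutes with convex hull, closure and interior, and a lattice
  automorphism permutes the nonzero lattice points.\<close>

lemma sail_linear_image:
  fixes g :: "real ^ 'n \<Rightarrow> real ^ 'n"
  assumes "linear g" "g ` integer_lattice = integer_lattice"
  shows "sail (g ` C) = g ` sail C"
proof -
  have bij: "bij g" using assms by (rule bij_of_lattice_automorphism)
  then have inj: "inj g" by (rule bij_is_inj)
  have "(integer_lattice - {0}) \<inter> g ` C = g ` ((integer_lattice - {0}) \<inter> C)"
    using assms linear_0[OF assms(1)] by (simp add: image_Int[OF inj] image_set_diff[OF inj])
  then have "sail (g ` C) = frontier (g ` (convex hull ((integer_lattice - {0}) \<inter> C)))"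
    by (simp add: sail_def convex_hull_linear_image[OF assms(1)])
  also have "\<dots> = g ` sail C"
    unfolding sail_def frontier_def
    by (simp only: closure_injective_linear_image[OF assms(1) inj]
      interior_bijective_linear_image[OF assms(1) bij] image_set_diff[OF inj])
  finally show ?thesis .
qed

lemma eigen_hyperplanes_image_subset:
  fixes g :: "real ^ 'n \<Rightarrow> real ^ 'n"
  assumes "linear g" "bij g" "\<And>v. eigendirection A v \<Longrightarrow> eigendirection M (g v)"
  shows "image g ` eigen_hyperplanes A \<subseteq> eigen_hyperplanes M"
proof
  fix H assume "H \<in> image g ` eigen_hyperplanes A"
  then obtain S B where H: "H = g ` span S" and B: "eigenbasis A B" and S: "S \<subseteq> B" "card S = CARD('n) - 1"
    by (auto simp: eigen_hyperplanes_def)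
  have inj: "inj g" using assms(2) by (rule bij_is_inj)
  have "eigenbasis M (g ` B)"
    using B assms inj linear_independent_injective_image[OF assms(1)]
    by (auto simp: eigenbasis_def eigendirection_def linear_span_image bij_is_surj)
  moreover have "card (g ` S) = CARD('n) - 1"
    using S(2) inj by (simp add: card_image inj_on_subset)
  moreover have "H = span (g ` S)" using H assms(1) by (simp add: linear_span_image)
  ultimately show "H \<in> eigen_hyperplanes M"
    using S(1) by (auto simp: eigen_hyperplanes_def)
qed

text \<open>Eigenlines determine the hyperplanes, these the orthants, and orthants with the lattice
  the sails; \<open>g\<close> respects each stage.\<close>

lemma cf_equivalentI:
  fixes g :: "real ^ 'n \<Rightarrow> real ^ 'n"
  assumes g: "linear g" "g ` integer_lattice = integer_lattice"
    and dir: "\<And>v. eigendirection A v \<longleftrightarrow> eigendirection M (g v)"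
  shows "cf_equivalent (continued_fraction A) (continued_fraction M)"
proof -
  have bij: "bij g" using g by (rule bij_of_lattice_automorphism)
  have gi: "g (inv g x) = x" for x using bij by (simp add: bij_is_surj surj_f_inv_f)
  have "image g ` eigen_hyperplanes A = eigen_hyperplanes M"
  proof
    show "image g ` eigen_hyperplanes A \<subseteq> eigen_hyperplanes M"
      using g(1) bij dir by (intro eigen_hyperplanes_image_subset) auto
    have "image (inv g) ` eigen_hyperplanes M \<subseteq> eigen_hyperplanes A"
      using g(1) bij dir by (intro eigen_hyperplanes_image_subset linear_inv_bij bij_imp_bij_inv) (auto simp: gi)
    then have "image g ` image (inv g) ` eigen_hyperplanes M \<subseteq> image g ` eigen_hyperplanes A"
      by (rule image_mono)
    then show "eigen_hyperplanes M \<subseteq> image g ` eigen_hyperplanes A"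
      by (simp add: image_image gi)
  qed
  then have "- \<Union> (eigen_hyperplanes M) = g ` (- \<Union> (eigen_hyperplanes A))"
    using bij by (simp add: bij_image_Compl_eq image_Union)
  then have "orthants M = image g ` orthants A"
    using g(1) bij by (simp add: orthants_def components_linear_image)
  then have "continued_fraction M = image g ` continued_fraction A"
    using g by (simp add: continued_fraction_def image_image sail_linear_image)
  then show ?thesis using g by (auto simp: cf_equivalent_def)
qed

lemma cf_equivalent_trans:
  assumes "cf_equivalent F G" "cf_equivalent G H"
  shows "cf_equivalent F H"
proof -
  obtain g h where g: "linear g" "g ` integer_lattice = integer_lattice" "image g ` F = G"
    and h: "linear h" "h ` integer_lattice = integer_lattice" "image h ` G = H"
    using assms by (auto simp: cf_equivalent_def)
  have "image (h \<circ> g) ` F = H"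
    by (simp add: g(3)[symmetric] h(3)[symmetric] image_image)
  moreover have "(h \<circ> g) ` integer_lattice = integer_lattice"
    by (simp only: image_comp[symmetric] g(2) h(2))
  ultimately show ?thesis
    unfolding cf_equivalent_def using linear_compose[OF g(1) h(1)] by blast
qed

lemma cf_equivalent_sym:
  assumes "cf_equivalent F G"
  shows "cf_equivalent G F"
proof -
  obtain g where g: "linear g" "g ` integer_lattice = integer_lattice" "image g ` F = G"
    using assms by (auto simp: cf_equivalent_def)
  have bij: "bij g" using g(1,2) by (rule bij_of_lattice_automorphism)
  have "image (inv g) ` G = F"
    using bij by (simp add: g(3)[symmetric] image_image bij_is_inj)
  then show ?thesis
    using linear_inv_bij[OF g(1) bij] inv_lattice[OF bij g(2)] by (auto simp: cf_equivalent_def)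
qed

section \<open>Integer intertwiners\<close>

lemma map_matrix_of_int_mult:
  "map_matrix (of_int :: int \<Rightarrow> 'a::comm_ring_1) (A ** B) = map_matrix of_int A ** map_matrix of_int B"
  by (simp add: vec_eq_iff map_matrix_def matrix_matrix_mult_def)

lemma map_matrix_of_int_mat: "map_matrix (of_int :: int \<Rightarrow> 'a::comm_ring_1) (mat k) = mat (of_int k)"
  by (simp add: vec_eq_iff map_matrix_def mat_def)

lemma map_matrix_of_int_add:
  "map_matrix (of_int :: int \<Rightarrow> 'a::comm_ring_1) (A + B) = map_matrix of_int A + map_matrix of_int B"
  by (simp add: vec_eq_iff map_matrix_def)

lemma mat_mult_vec: "mat c *v v = c *s v" for v :: "'a::semiring_1 ^ 'n"
  by (simp add: vec_eq_iff matrix_vector_mult_def mat_def if_distrib[of "\<lambda>a. a * _"] cong: if_cong)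

text \<open>For matrices of size 3, Cayley-Hamilton brings every polynomial in \<open>A\<close> to
  this form.\<close>

fun matrix_quadratic :: "int \<times> int \<times> int \<Rightarrow> int ^ 'n ^ 'n \<Rightarrow> int ^ 'n ^ 'n" where
  "matrix_quadratic (q0, q1, q2) A = mat q0 + mat q1 ** A + mat q2 ** (A ** A)"

lemma eigenvector_matrix_quadratic:
  fixes A :: "int ^ 'n ^ 'n"
  assumes "eigenvector (map_matrix real_of_int A) v c"
  shows "\<exists>c'. eigenvector (map_matrix real_of_int (matrix_quadratic q A)) v c'"
proof -
  obtain q0 q1 q2 where q: "q = (q0, q1, q2)" by (metis prod.exhaust)
  let ?A = "map_matrix real_of_int A"
  have v: "v \<noteq> 0" "?A *v v = c *s v" using assms by (auto simp: eigenvector_def)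
  have "map_matrix real_of_int (matrix_quadratic q A) *v v = (q0 + q1 * c + q2 * c^2) *s v"
    by (simp del: vector_sadd_rdistrib add: q map_matrix_of_int_add map_matrix_of_int_mult map_matrix_of_int_mat
      matrix_vector_mult_add_rdistrib mat_mult_vec v vector_scalar_commute
      vec_eq_iff algebra_simps power2_eq_square flip: matrix_vector_mul_assoc)
  then have "eigenvector (map_matrix real_of_int (matrix_quadratic q A)) v (q0 + q1 * c + q2 * c^2)"
    using v(1) unfolding eigenvector_def by blast
  then show ?thesis ..
qed

lemma lattice_image_subset:
  "(\<lambda>v. map_matrix real_of_int X *v v) ` integer_lattice \<subseteq> integer_lattice"
  by (auto simp: integer_lattice_def matrix_vector_mult_def map_matrix_def intro!: Ints_sum Ints_mult)

text \<open>\<open>X\<close> conjugates q(A) to \<open>M\<close> and \<open>A\<close> to r(M). An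
  eigenvector of a matrix is one of every polynomial in it, so the first relation carries
  eigendirections forward and the second carries them back.\<close>

lemma cf_equivalent_intertwiner:
  fixes A M X Y :: "int ^ 'n ^ 'n"
  assumes XY: "X ** Y = mat 1" "Y ** X = mat 1"
    and q: "X ** matrix_quadratic q A = M ** X"
    and r: "X ** A = matrix_quadratic r M ** X"
  shows "cf_equivalent (continued_fraction A) (continued_fraction M)"
proof (rule cf_equivalentI)
  let ?r = "map_matrix real_of_int :: int ^ 'n ^ 'n \<Rightarrow> real ^ 'n ^ 'n"
  let ?g = "\<lambda>v. ?r X *v v" and ?h = "\<lambda>v. ?r Y *v v"
  have gh: "?g (?h v) = v" and hg: "?h (?g v) = v" for v
    using XY by (simp_all add: matrix_vector_mul_assoc map_matrix_of_int_mat flip: map_matrix_of_int_mult)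
  show "linear ?g" by (rule matrix_vector_mul_linear)
  \<comment> \<open>Both \<open>X\<close> and \<open>Y\<close> map the lattice into itself, and they
    are mutually inverse, so \<open>X\<close> maps it onto itself.\<close>
  have "?g ` ?h ` integer_lattice \<subseteq> ?g ` integer_lattice"
    by (intro image_mono lattice_image_subset)
  then have "integer_lattice \<subseteq> ?g ` integer_lattice"
    by (simp only: image_image gh image_ident)
  then show "?g ` integer_lattice = integer_lattice"
    using lattice_image_subset[of X] by blast
  fix v
  have nz: "?g v = 0 \<longleftrightarrow> v = 0" using hg by (metis matrix_vector_mult_0_right)
  show "eigendirection A v \<longleftrightarrow> eigendirection M (?g v)"
  proof
    assume "eigendirection A v"
    then obtain c where "eigenvector (?r (matrix_quadratic q A)) v c"
      using eigenvector_matrix_quadratic unfolding eigendirection_def by blast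
    then have "v \<noteq> 0" "?r M *v ?g v = c *s ?g v"
      unfolding eigenvector_def matrix_vector_mul_assoc map_matrix_of_int_mult[symmetric] q[symmetric]
      by (simp_all add: map_matrix_of_int_mult vector_scalar_commute flip: matrix_vector_mul_assoc)
    then show "eigendirection M (?g v)"
      using nz by (auto simp: eigendirection_def eigenvector_def)
  next
    assume "eigendirection M (?g v)"
    then obtain c where "eigenvector (?r (matrix_quadratic r M)) (?g v) c"
      using eigenvector_matrix_quadratic unfolding eigendirection_def by blast
    then have "?g v \<noteq> 0" and "?r (matrix_quadratic r M) *v ?g v = c *s ?g v"
      by (auto simp: eigenvector_def)
    then have "?g (?r A *v v) = ?g (c *s v)"
      unfolding matrix_vector_mul_assoc map_matrix_of_int_mult[symmetric] r[symmetric]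
      by (simp add: map_matrix_of_int_mult vector_scalar_commute flip: matrix_vector_mul_assoc)
    then have "?r A *v v = c *s v" using hg by metis
    then show "eigendirection A v"
      using nz \<open>?g v \<noteq> 0\<close> by (auto simp: eigendirection_def eigenvector_def)
  qed
qed

section \<open>Recovering the eigendirections from the sails\<close>

text \<open>An eigenbasis \<open>p\<close> with its dual coordinates \<open>coord\<close>. In these
  coordinates orthants are sign conditions, and \<open>inj_c\<close> makes the eigenspaces
  lines.\<close>

locale eigenframe =
  fixes A :: "int ^ 'n ^ 'n" and p :: "'n \<Rightarrow> real ^ 'n" and c :: "'n \<Rightarrow> real"
    and coord :: "'n \<Rightarrow> real ^ 'n \<Rightarrow> real"
  assumes linear_coord: "linear (coord i)"
    and expand: "(\<Sum>i\<in>UNIV. coord i x *\<^sub>R p i) = x"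
    and coord_p: "coord i (p j) = (if i = j then 1 else 0)"
    and eigen: "map_matrix real_of_int A *v p i = c i *\<^sub>R p i"
    and inj_c: "inj c"
begin

lemma coord_eqI: "(\<And>i. coord i x = coord i y) \<Longrightarrow> x = y"
  by (metis (no_types, lifting) expand sum.cong)

lemma coord_scaleR: "coord i (a *\<^sub>R x) = a * coord i x"
  by (simp add: linear_cmul[OF linear_coord])

lemma coord_add: "coord i (x + y) = coord i x + coord i y"
  by (simp add: linear_add[OF linear_coord])

lemma coord_diff: "coord i (x - y) = coord i x - coord i y"
  by (simp add: linear_diff[OF linear_coord])

lemma coord_0: "coord i 0 = 0"
  by (simp add: linear_0[OF linear_coord])

lemma coord_sum: "coord i (\<Sum>j\<in>UNIV. a j *\<^sub>R p j) = a i"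
  by (simp add: linear_sum[OF linear_coord] coord_scaleR coord_p if_distrib[of "\<lambda>b. _ * b"] cong: if_cong)

lemma coord_image: "coord i (map_matrix real_of_int A *v x) = c i * coord i x"
proof -
  have "map_matrix real_of_int A *v x = (\<Sum>j\<in>UNIV. (c j * coord j x) *\<^sub>R p j)"
    by (subst expand[of x, symmetric])
      (simp add: linear_sum[OF matrix_vector_mul_linear] matrix_vector_mult_scaleR eigen mult.commute)
  then show ?thesis by (simp add: coord_sum)
qed

lemma p_nonzero: "p i \<noteq> 0"
  using coord_p[of i i] coord_0[of i] by auto

lemma eigendirection_p: "eigendirection A (p i)"
  unfolding eigendirection_def eigenvector_def
  using p_nonzero eigen by (auto simp: scalar_mult_eq_scaleR)

text \<open>Each coordinate of an eigenvector is multiplied both by \<open>c i\<close> and by the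
  common eigenvalue, so distinct \<open>c i\<close> leave only one nonzero coordinate.\<close>

lemma eigendirection_cases:
  assumes "eigendirection A v"
  obtains a i where "v = a *\<^sub>R p i"
proof -
  obtain m where v: "v \<noteq> 0" "map_matrix real_of_int A *v v = m *\<^sub>R v"
    using assms by (auto simp: eigendirection_def eigenvector_def scalar_mult_eq_scaleR)
  have eq: "c i * coord i v = m * coord i v" for i
    using coord_image[of i v] by (auto simp: v(2) coord_scaleR)
  obtain j where j: "coord j v \<noteq> 0"
    using v(1) coord_eqI[of v 0] by (auto simp: coord_0)
  have m: "c i = m" if "coord i v \<noteq> 0" for i using eq[of i] that by simp
  have "coord i v = coord i (coord j v *\<^sub>R p j)" for i
  proof (cases "i = j")
    case False
    then have "coord i v = 0" using m[of i] m[OF j] injD[OF inj_c, of i j] by auto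
    then show ?thesis using False by (simp add: coord_scaleR coord_p)
  qed (simp add: coord_scaleR coord_p)
  then show thesis using that coord_eqI by blast
qed

text \<open>At most as many vectors as the dimension that still span must be independent.\<close>

lemma eigenbasis_range: "eigenbasis A (range p)"
proof -
  have span: "span (range p) = UNIV"
  proof -
    have "x \<in> span (range p)" for x
      by (subst expand[of x, symmetric]) (intro span_sum span_scale span_base rangeI)
    then show ?thesis by blast
  qed
  have "card (range p) \<le> dim (UNIV :: (real ^ 'n) set)"
    using card_image_le[of UNIV p] by (simp add: dim_UNIV)
  then have "independent (range p)"
    using span by (intro card_le_dim_spanning[of _ UNIV]) auto
  then show ?thesis
    using span eigendirection_p by (auto simp: eigenbasis_def eigendirection_def)
qed

lemma inj_p: "inj p"
  by (rule injI) (metis coord_p zero_neq_one)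

text \<open>Whatever the chosen eigenbasis, its members are multiples of the \<open>p j\<close>, so
  the hyperplanes are the coordinate hyperplanes of the frame.\<close>

lemma Union_eigen_hyperplanes: "\<Union> (eigen_hyperplanes A) = {x. \<exists>i. coord i x = 0}"
proof (intro set_eqI iffI)
  fix x assume "x \<in> \<Union> (eigen_hyperplanes A)"
  then obtain S B where x: "x \<in> span S" and B: "eigenbasis A B" and S: "S \<subseteq> B" "card S = CARD('n) - 1"
    by (auto simp: eigen_hyperplanes_def)
  have "finite S"
    using B S(1) by (auto simp: eigenbasis_def intro: finite_subset independent_imp_finite)
  have "\<forall>b\<in>S. \<exists>j a. b = a *\<^sub>R p j"
    using B S(1) eigendirection_cases by (metis eigenbasis_def eigendirection_def subsetD)
  then obtain j where j: "\<forall>b\<in>S. \<exists>a. b = a *\<^sub>R p (j b)" by metis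
  \<comment> \<open>By pigeonhole, one fewer vector than the dimension misses some index
    \<open>i\<close>, whose coordinate then vanishes on the whole span.\<close>
  have "card (j ` S) < CARD('n)"
    using card_image_le[OF \<open>finite S\<close>, of j] S(2) zero_less_card_finite[where 'a='n] by linarith
  then obtain i where i: "i \<notin> j ` S" by (metis UNIV_eq_I less_irrefl)
  have "S \<subseteq> {y. coord i y = 0}"
  proof
    fix b assume "b \<in> S"
    moreover from this obtain a where "b = a *\<^sub>R p (j b)" using j by blast
    ultimately show "b \<in> {y. coord i y = 0}"
      using i coord_scaleR[of i a "p (j b)"] coord_p[of i "j b"] by auto
  qed
  moreover have "subspace {y. coord i y = 0}"
    by (simp add: subspace_def coord_0 coord_add coord_scaleR)
  ultimately have "span S \<subseteq> {y. coord i y = 0}" by (rule span_minimal)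
  then show "x \<in> {x. \<exists>i. coord i x = 0}" using x by blast
next
  fix x assume "x \<in> {x. \<exists>i. coord i x = 0}"
  then obtain i where i: "coord i x = 0" by blast
  have "x = (\<Sum>j\<in>UNIV - {i}. coord j x *\<^sub>R p j)"
    using expand[of x] i by (simp add: sum.remove[of UNIV i])
  also have "\<dots> \<in> span (p ` (UNIV - {i}))"
    by (intro span_sum span_scale span_base) auto
  finally have "x \<in> span (p ` (UNIV - {i}))" .
  moreover have "card (p ` (UNIV - {i})) = CARD('n) - 1"
    using inj_p by (simp add: card_image inj_on_subset)
  then have "span (p ` (UNIV - {i})) \<in> eigen_hyperplanes A"
    unfolding eigen_hyperplanes_def
    by (intro CollectI exI[of _ "p ` (UNIV - {i})"] exI[of _ "range p"] conjI refl eigenbasis_range) auto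
  ultimately show "x \<in> \<Union> (eigen_hyperplanes A)" by blast
qed

section \<open>Orthants as sign cones and their sails\<close>

text \<open>The signs are given by arbitrary reals, not only 1 and -1, so that the coordinates of
  any interior point can serve as \<open>\<sigma>\<close>.\<close>

definition orthant :: "('n \<Rightarrow> real) \<Rightarrow> (real ^ 'n) set" where
  "orthant \<sigma> = {x. \<forall>i. \<sigma> i * coord i x > 0}"

definition closed_orthant :: "('n \<Rightarrow> real) \<Rightarrow> (real ^ 'n) set" where
  "closed_orthant \<sigma> = {x. \<forall>i. \<sigma> i * coord i x \<ge> 0}"

lemma continuous_coord: "continuous_on S (coord i)"
  using linear_coord by (simp add: linear_continuous_on linear_conv_bounded_linear)

lemma open_orthant: "open (orthant \<sigma>)"
proof -
  have "orthant \<sigma> = (\<Inter>i\<in>UNIV. {x. \<sigma> i * coord i x > 0})" by (auto simp: orthant_def)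
  moreover have "open {x. \<sigma> i * coord i x > 0}" for i
    by (intro open_Collect_less continuous_intros continuous_coord)
  ultimately show ?thesis by (simp add: open_INT)
qed

lemma closed_closed_orthant: "closed (closed_orthant \<sigma>)"
proof -
  have "closed_orthant \<sigma> = (\<Inter>i. {x. \<sigma> i * coord i x \<ge> 0})" by (auto simp: closed_orthant_def)
  moreover have "closed {x. \<sigma> i * coord i x \<ge> 0}" for i
    by (intro closed_Collect_le continuous_intros continuous_coord)
  ultimately show ?thesis by (simp add: closed_INT)
qed

lemma convex_orthant: "convex (orthant \<sigma>)"
proof (rule convexI)
  fix x y u v assume *: "x \<in> orthant \<sigma>" "y \<in> orthant \<sigma>" "0 \<le> u" "0 \<le> v" "u + v = (1::real)"
  have "0 < \<sigma> i * coord i (u *\<^sub>R x + v *\<^sub>R y)" for i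
  proof -
    have x: "\<sigma> i * coord i x > 0" and y: "\<sigma> i * coord i y > 0"
      using * by (simp_all add: orthant_def)
    have "0 < u * (\<sigma> i * coord i x) + v * (\<sigma> i * coord i y)"
    proof (cases "u = 0")
      case True
      then show ?thesis using * y by simp
    next
      case False
      then have "0 < u * (\<sigma> i * coord i x)" using * x by (intro mult_pos_pos[of u]) auto
      moreover have "0 \<le> v * (\<sigma> i * coord i y)" using * y by (intro mult_nonneg_nonneg[of v]) auto
      ultimately show ?thesis by simp
    qed
    then show ?thesis by (simp add: coord_add coord_scaleR algebra_simps)
  qed
  then show "u *\<^sub>R x + v *\<^sub>R y \<in> orthant \<sigma>" by (simp add: orthant_def)
qed

lemma closed_orthant_add: "x \<in> closed_orthant \<sigma> \<Longrightarrow> y \<in> closed_orthant \<sigma> \<Longrightarrow> x + y \<in> closed_orthant \<sigma>"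
  by (simp add: closed_orthant_def coord_add distrib_left)

lemma closed_orthant_scaleR: "a \<ge> 0 \<Longrightarrow> x \<in> closed_orthant \<sigma> \<Longrightarrow> a *\<^sub>R x \<in> closed_orthant \<sigma>"
  unfolding closed_orthant_def mem_Collect_eq coord_scaleR mult.left_commute[of _ a]
  by (blast intro: mult_nonneg_nonneg)

lemma convex_closed_orthant: "convex (closed_orthant \<sigma>)"
  by (intro convexI closed_orthant_add closed_orthant_scaleR)

lemma orthant_scaleR: "a > 0 \<Longrightarrow> x \<in> orthant \<sigma> \<Longrightarrow> a *\<^sub>R x \<in> orthant \<sigma>"
  unfolding orthant_def mem_Collect_eq coord_scaleR mult.left_commute[of _ a]
  by (blast intro: mult_pos_pos)

lemma orthant_subset: "orthant \<sigma> \<subseteq> closed_orthant \<sigma>"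
  by (auto simp: orthant_def closed_orthant_def less_imp_le)

text \<open>The coordinates of a point \<open>x\<close> of the component serve as signs. Their
  orthant is convex and avoids the hyperplanes, so it lies in the component; conversely, no
  coordinate can change sign on a connected set where it has no zero.\<close>

lemma orthants_cases:
  assumes "C \<in> orthants A"
  obtains \<sigma> where "\<And>i. \<sigma> i \<noteq> 0" "C = orthant \<sigma>"
proof -
  have C: "C \<in> components {x. \<forall>i. coord i x \<noteq> 0}"
    using assms by (simp add: orthants_def Union_eigen_hyperplanes Collect_neg_eq[symmetric])
  obtain x where x: "x \<in> C" using in_components_nonempty[OF C] by blast
  define \<sigma> where "\<sigma> i = coord i x" for i
  have nz: "coord i y \<noteq> 0" if "y \<in> C" for i y
    using in_components_subset[OF C] that by blast
  have "x \<in> orthant \<sigma>"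
    using nz[OF x] by (simp add: orthant_def \<sigma>_def zero_less_mult_iff linorder_neq_iff disj_commute)
  moreover have "orthant \<sigma> \<subseteq> {x. \<forall>i. coord i x \<noteq> 0}"
    by (auto simp: orthant_def) (metis less_irrefl mult_zero_right)
  ultimately have "orthant \<sigma> \<subseteq> C"
    using components_maximal[OF C convex_connected[OF convex_orthant]] x by blast
  moreover have "C \<subseteq> orthant \<sigma>"
  proof
    fix y assume y: "y \<in> C"
    have "\<sigma> i * coord i y > 0" for i
    proof (rule ccontr)
      assume "\<not> \<sigma> i * coord i y > 0"
      then have "coord i x \<le> 0 \<and> 0 \<le> coord i y \<or> coord i y \<le> 0 \<and> 0 \<le> coord i x"
        by (auto simp: \<sigma>_def not_less mult_le_0_iff)
      then have "0 \<in> {coord i x..coord i y} \<union> {coord i y..coord i x}" by auto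
      moreover have con: "connected (coord i ` C)"
        using in_components_connected[OF C] by (intro connected_continuous_image continuous_coord)
      ultimately have "0 \<in> coord i ` C"
        using connected_contains_Icc[OF con imageI[OF x] imageI[OF y]]
          connected_contains_Icc[OF con imageI[OF y] imageI[OF x]] by blast
      then show False using nz by auto
    qed
    then show "y \<in> orthant \<sigma>" by (simp add: orthant_def)
  qed
  ultimately show thesis using that[of \<sigma>] nz[OF x] by (auto simp: \<sigma>_def)
qed

lemma orthants_nonempty: "orthants A \<noteq> {}"
proof -
  have "(\<Sum>j\<in>UNIV. 1 *\<^sub>R p j) \<in> - \<Union> (eigen_hyperplanes A)"
    by (simp add: Union_eigen_hyperplanes coord_sum del: scaleR_one)
  then show ?thesis by (auto simp: orthants_def components_eq_empty)
qed

lemma sail_orthant_subset: "sail (orthant \<sigma>) \<subseteq> closed_orthant \<sigma>"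
proof -
  have "convex hull ((integer_lattice - {0}) \<inter> orthant \<sigma>) \<subseteq> closed_orthant \<sigma>"
    using orthant_subset convex_closed_orthant by (intro hull_minimal) auto
  then show ?thesis
    unfolding sail_def frontier_def using closure_minimal[OF _ closed_closed_orthant] by blast
qed

lemma lattice_norm_ge_1:
  assumes "x \<in> integer_lattice" "x \<noteq> (0 :: real ^ 'm)"
  shows "norm x \<ge> 1"
proof -
  obtain i where "x $ i \<noteq> 0" using assms(2) by (auto simp: vec_eq_iff)
  then have "\<bar>x $ i\<bar> \<ge> 1"
    using assms(1) by (auto simp: integer_lattice_def Ints_nonzero_abs_ge1)
  then show ?thesis using component_le_norm_cart[of x i] by linarith
qed

text \<open>The sum \<open>h\<close> of the signed coordinates is comparable to the norm on the cone, hence bounded away from zero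
  on the hull of the lattice points, so the ray from the origin through a lattice point of the
  cone has to enter the hull.\<close>

lemma ray_meets_sail:
  assumes x: "x \<in> integer_lattice" "x \<in> orthant \<sigma>" and \<sigma>: "\<And>i. \<sigma> i \<noteq> 0"
  obtains t where "t > 0" "t *\<^sub>R x \<in> sail (orthant \<sigma>)"
proof -
  define h where "h y = (\<Sum>i\<in>UNIV. \<sigma> i * coord i y)" for y
  \<comment> \<open>In the orthant all summands of \<open>h\<close> are positive, so each bounds one
    coordinate by \<open>h y\<close>; summing over the frame gives norm y \<le> m * h y.\<close>
  define m where "m = (\<Sum>i\<in>UNIV. norm (p i) / \<bar>\<sigma> i\<bar>)"
  let ?L = "(integer_lattice - {0}) \<inter> orthant \<sigma>"
  let ?K = "convex hull ?L"
  have m: "m > 0" unfolding m_def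
    using \<sigma> p_nonzero by (intro sum_pos) auto
  have norm_le: "norm y \<le> m * h y" if "y \<in> orthant \<sigma>" for y
  proof -
    have pos: "\<sigma> i * coord i y > 0" for i using that by (simp add: orthant_def)
    have "norm y \<le> (\<Sum>i\<in>UNIV. norm (coord i y *\<^sub>R p i))"
      using norm_sum[of "\<lambda>i. coord i y *\<^sub>R p i" UNIV] by (simp only: expand)
    also have "\<dots> \<le> (\<Sum>i\<in>UNIV. norm (p i) / \<bar>\<sigma> i\<bar> * h y)"
    proof (rule sum_mono)
      fix i
      have "\<sigma> i * coord i y \<le> h y" unfolding h_def
        using pos by (intro member_le_sum) (auto simp: less_imp_le)
      then have "\<bar>\<sigma> i\<bar> * \<bar>coord i y\<bar> \<le> h y"
        using pos[of i] by (simp flip: abs_mult)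
      then have "\<bar>coord i y\<bar> \<le> h y / \<bar>\<sigma> i\<bar>"
        using \<sigma>[of i] by (simp add: field_simps)
      then have "\<bar>coord i y\<bar> * norm (p i) \<le> h y / \<bar>\<sigma> i\<bar> * norm (p i)"
        by (rule mult_right_mono) simp
      then show "norm (coord i y *\<^sub>R p i) \<le> norm (p i) / \<bar>\<sigma> i\<bar> * h y"
        by (simp add: mult.commute)
    qed
    finally show ?thesis by (simp add: m_def sum_distrib_right)
  qed
  have h_scaleR: "h (a *\<^sub>R y) = a * h y" for a y
    by (simp add: h_def coord_scaleR sum_distrib_left mult.left_commute)
  have h_add: "h (y + z) = h y + h z" for y z
    by (simp add: h_def coord_add sum.distrib distrib_left)
  have "?K \<subseteq> {y. h y \<ge> 1 / m}"
  proof (rule hull_minimal)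
    show "?L \<subseteq> {y. h y \<ge> 1 / m}"
    proof
      fix y assume y: "y \<in> ?L"
      then have "1 \<le> m * h y"
        using norm_le[of y] lattice_norm_ge_1[of y] by auto
      then show "y \<in> {y. h y \<ge> 1 / m}" using m by (simp add: field_simps)
    qed
    show "convex {y. h y \<ge> 1 / m}"
    proof (rule convexI)
      fix y z u v assume *: "y \<in> {y. h y \<ge> 1 / m}" "z \<in> {y. h y \<ge> 1 / m}" "0 \<le> u" "0 \<le> v" "u + v = (1::real)"
      have "1 / m = u * (1 / m) + v * (1 / m)" using *(5) by (metis distrib_right mult_1)
      also have "\<dots> \<le> u * h y + v * h z" using * by (intro add_mono mult_left_mono) auto
      finally show "u *\<^sub>R y + v *\<^sub>R z \<in> {y. h y \<ge> 1 / m}" by (simp add: h_add h_scaleR)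
    qed
  qed
  have "x \<noteq> 0" using x(2) by (auto simp: orthant_def coord_0)
  then have "x \<in> ?K" using x by (simp add: hull_inc)
  then have hx: "h x \<ge> 1 / m" using \<open>?K \<subseteq> _\<close> by blast
  then have "h x > 0" using m by (meson less_le_trans zero_less_divide_1_iff)
  let ?R = "(\<lambda>t. t *\<^sub>R x) ` {0<..1}"
  have "connected ?R"
    by (intro connected_continuous_image continuous_intros) auto
  moreover have "?R \<inter> ?K \<noteq> {}"
    using \<open>x \<in> ?K\<close> by (auto intro!: exI[of _ x] image_eqI[of _ _ 1])
  moreover have "?R - ?K \<noteq> {}"
  proof -
    \<comment> \<open>At this scale \<open>h\<close> takes the value 1 / (2 m), half its lower bound
      on the hull.\<close>
    define t where "t = 1 / (2 * m * h x)"
    have "t > 0" using m \<open>h x > 0\<close> by (simp add: t_def)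
    moreover have "t \<le> 1" using hx m \<open>h x > 0\<close> by (simp add: t_def field_simps)
    moreover have "h (t *\<^sub>R x) < 1 / m"
      using m \<open>h x > 0\<close> by (simp add: h_scaleR t_def field_simps)
    then have "t *\<^sub>R x \<notin> ?K" using \<open>?K \<subseteq> _\<close> by (auto simp: not_le)
    ultimately have "t *\<^sub>R x \<in> ?R - ?K" by (auto intro!: imageI)
    then show ?thesis by blast
  qed
  ultimately have "?R \<inter> frontier ?K \<noteq> {}" by (rule connected_Int_frontier)
  then show thesis using that unfolding sail_def by auto
qed

text \<open>Rescaled lattice points are dense in the open orthant, and the open orthant is dense in
  the closed one. A closed set stable under these rescalings that contains the images of the lattice
  points therefore contains the whole image.\<close>

lemma image_closed_orthant_subset:
  fixes g :: "real ^ 'n \<Rightarrow> real ^ 'm"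
  assumes g: "linear g" and D: "closed D" "\<And>a x. a > 0 \<Longrightarrow> a *\<^sub>R x \<in> D \<Longrightarrow> x \<in> D"
    and lat: "\<And>x. x \<in> integer_lattice \<Longrightarrow> x \<in> orthant \<sigma> \<Longrightarrow> g x \<in> D"
    and \<sigma>: "\<And>i. \<sigma> i \<noteq> 0"
  shows "g ` closed_orthant \<sigma> \<subseteq> D"
proof -
  have cont: "isCont g y" for y
    by (rule linear_continuous_at[OF iffD1[OF linear_conv_bounded_linear g]])
  have open_part: "g y \<in> D" if y: "y \<in> orthant \<sigma>" for y
  proof -
    \<comment> \<open>Rounding down the (n + 1)-fold of \<open>y\<close> and scaling back moves each
      coordinate by at most 1 / (n + 1).\<close>
    define z :: "nat \<Rightarrow> real ^ 'n" where "z n = (\<chi> i. of_int \<lfloor>real (Suc n) * y $ i\<rfloor>) /\<^sub>R real (Suc n)" for n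
    have "z \<longlonglongrightarrow> y"
    proof (rule vec_tendstoI)
      fix i
      have "(\<lambda>n. z n $ i - y $ i) \<longlonglongrightarrow> 0"
      proof (rule Lim_null_comparison[OF _ LIMSEQ_inverse_real_of_nat], rule always_eventually, rule allI)
        fix n
        have "z n $ i - y $ i = (of_int \<lfloor>real (Suc n) * y $ i\<rfloor> - real (Suc n) * y $ i) / real (Suc n)"
          by (simp add: z_def field_simps)
        also have "\<bar>\<dots>\<bar> \<le> 1 / real (Suc n)"
          unfolding abs_divide abs_of_nat by (intro divide_right_mono) linarith+
        finally show "norm (z n $ i - y $ i) \<le> inverse (real (Suc n))"
          by (simp add: inverse_eq_divide)
      qed
      then show "(\<lambda>n. z n $ i) \<longlonglongrightarrow> y $ i" by (simp add: LIM_zero_iff)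
    qed
    then have "\<forall>\<^sub>F n in sequentially. z n \<in> orthant \<sigma>"
      using open_orthant y by (rule topological_tendstoD)
    then have "\<forall>\<^sub>F n in sequentially. g (z n) \<in> D"
    proof (rule eventually_mono)
      fix n assume zn: "z n \<in> orthant \<sigma>"
      have *: "real (Suc n) *\<^sub>R z n = (\<chi> i. of_int \<lfloor>real (Suc n) * y $ i\<rfloor>)"
        by (simp add: z_def)
      have "real (Suc n) *\<^sub>R z n \<in> orthant \<sigma>" using zn by (intro orthant_scaleR) simp_all
      moreover have "real (Suc n) *\<^sub>R z n \<in> integer_lattice"
        unfolding * by (simp add: integer_lattice_def)
      ultimately have "g (real (Suc n) *\<^sub>R z n) \<in> D" by (intro lat)
      then have "real (Suc n) *\<^sub>R g (z n) \<in> D" by (simp add: linear_cmul[OF g])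
      then show "g (z n) \<in> D" by (rule D(2)[rotated]) simp
    qed
    moreover have "(\<lambda>n. g (z n)) \<longlonglongrightarrow> g y"
      using cont \<open>z \<longlonglongrightarrow> y\<close> by (rule isCont_tendsto_compose)
    ultimately show ?thesis using D(1) by (intro Lim_in_closed_set[of D "\<lambda>n. g (z n)" sequentially]) auto
  qed
  show ?thesis
  proof
    fix w assume "w \<in> g ` closed_orthant \<sigma>"
    then obtain y where w: "w = g y" and y: "y \<in> closed_orthant \<sigma>" by auto
    \<comment> \<open>The direction \<open>s\<close> has signed coordinates
      \<open>\<sigma> i * \<sigma> i\<close>, all positive, so adding a small multiple of it moves
      \<open>y\<close> into the open orthant.\<close>
    define s where "s = (\<Sum>j\<in>UNIV. \<sigma> j *\<^sub>R p j)"
    define z where "z n = y + inverse (real (Suc n)) *\<^sub>R s" for n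
    have "\<sigma> i * coord i (z n) > 0" for i n
    proof -
      have "\<sigma> i * coord i (z n) = \<sigma> i * coord i y + inverse (real (Suc n)) * (\<sigma> i * \<sigma> i)"
        by (simp add: z_def s_def coord_add coord_scaleR coord_sum algebra_simps)
      moreover have "inverse (real (Suc n)) * (\<sigma> i * \<sigma> i) > 0"
        by (rule mult_pos_pos) (simp, use \<sigma>[of i] not_real_square_gt_zero[of "\<sigma> i"] in blast)
      ultimately show ?thesis using y by (simp add: closed_orthant_def add_nonneg_pos)
    qed
    then have "g (z n) \<in> D" for n by (intro open_part) (simp add: orthant_def)
    moreover have "z \<longlonglongrightarrow> y + 0 *\<^sub>R s"
      unfolding z_def by (intro tendsto_intros LIMSEQ_inverse_real_of_nat)
    then have "(\<lambda>n. g (z n)) \<longlonglongrightarrow> g y"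
      using cont by (intro isCont_tendsto_compose[OF cont]) simp
    ultimately show "w \<in> D"
      unfolding w using D(1) by (intro Lim_in_closed_set[of D "\<lambda>n. g (z n)" sequentially]) auto
  qed
qed

end

text \<open>A single pair of corresponding sails is enough. Every ray through a lattice point of the
  orthant meets its sail, so \<open>g\<close> and its inverse map the closed orthants of the pair
  into each other; the frame vectors span their extreme rays.\<close>

lemma cf_equivalent_eigenframes:
  fixes A M :: "int ^ 'n ^ 'n"
  assumes A: "eigenframe A p c coord" and M: "eigenframe M p' c' coord'"
    and equiv: "cf_equivalent (continued_fraction A) (continued_fraction M)"
  obtains g where "linear g" "g ` integer_lattice = integer_lattice"
    "\<And>i. \<exists>j b. g (p i) = b *\<^sub>R p' j"
proof -
  interpret A: eigenframe A p c coord by (rule A)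
  interpret M: eigenframe M p' c' coord' by (rule M)
  obtain g where g: "linear g" "g ` integer_lattice = integer_lattice"
    "image g ` continued_fraction A = continued_fraction M"
    using equiv by (auto simp: cf_equivalent_def)
  have bij: "bij g" using g(1,2) by (rule bij_of_lattice_automorphism)
  let ?h = "inv g"
  have h: "linear ?h" "?h ` integer_lattice = integer_lattice"
    using linear_inv_bij[OF g(1) bij] inv_lattice[OF bij g(2)] by auto
  have hg: "?h (g x) = x" and gh: "g (?h x) = x" for x
    using bij by (simp_all add: bij_is_inj bij_is_surj surj_f_inv_f)
  obtain \<sigma> where \<sigma>: "\<And>i. \<sigma> i \<noteq> 0" "A.orthant \<sigma> \<in> orthants A"
    using A.orthants_nonempty A.orthants_cases by (metis ex_in_conv)
  then have "g ` sail (A.orthant \<sigma>) \<in> image g ` continued_fraction A"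
    unfolding continued_fraction_def by (intro imageI)
  then have "g ` sail (A.orthant \<sigma>) \<in> continued_fraction M"
    unfolding g(3) .
  then obtain C where "C \<in> orthants M" "g ` sail (A.orthant \<sigma>) = sail C"
    by (auto simp: continued_fraction_def)
  then obtain \<tau> where \<tau>: "\<And>i. \<tau> i \<noteq> 0" and sails: "g ` sail (A.orthant \<sigma>) = sail (M.orthant \<tau>)"
    by (metis M.orthants_cases)
  have sails': "?h ` sail (M.orthant \<tau>) = sail (A.orthant \<sigma>)"
    by (simp add: sails[symmetric] image_image hg)
  have "g ` A.closed_orthant \<sigma> \<subseteq> M.closed_orthant \<tau>"
  proof (rule A.image_closed_orthant_subset[OF g(1) M.closed_closed_orthant _ _ \<sigma>(1)])
    fix a x assume "a > 0" "a *\<^sub>R x \<in> M.closed_orthant \<tau>"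
    then show "x \<in> M.closed_orthant \<tau>"
      using M.closed_orthant_scaleR[of "inverse a" "a *\<^sub>R x"] by simp
  next
    fix x assume "x \<in> integer_lattice" "x \<in> A.orthant \<sigma>"
    then obtain t where t: "t > 0" "t *\<^sub>R x \<in> sail (A.orthant \<sigma>)"
      using \<sigma>(1) by (rule A.ray_meets_sail)
    then have "t *\<^sub>R g x \<in> M.closed_orthant \<tau>"
      using sails M.sail_orthant_subset by (auto simp flip: linear_cmul[OF g(1)])
    then show "g x \<in> M.closed_orthant \<tau>"
      using M.closed_orthant_scaleR[of "inverse t" "t *\<^sub>R g x"] t(1) by simp
  qed
  moreover have "?h ` M.closed_orthant \<tau> \<subseteq> A.closed_orthant \<sigma>"
  proof (rule M.image_closed_orthant_subset[OF h(1) A.closed_closed_orthant _ _ \<tau>])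
    fix a x assume "a > 0" "a *\<^sub>R x \<in> A.closed_orthant \<sigma>"
    then show "x \<in> A.closed_orthant \<sigma>"
      using A.closed_orthant_scaleR[of "inverse a" "a *\<^sub>R x"] by simp
  next
    fix x assume "x \<in> integer_lattice" "x \<in> M.orthant \<tau>"
    then obtain t where t: "t > 0" "t *\<^sub>R x \<in> sail (M.orthant \<tau>)"
      using \<tau> by (rule M.ray_meets_sail)
    then have "t *\<^sub>R ?h x \<in> A.closed_orthant \<sigma>"
      using sails' A.sail_orthant_subset by (auto simp flip: linear_cmul[OF h(1)])
    then show "?h x \<in> A.closed_orthant \<sigma>"
      using A.closed_orthant_scaleR[of "inverse t" "t *\<^sub>R ?h x"] t(1) by simp
  qed
  ultimately have into: "\<And>x. x \<in> A.closed_orthant \<sigma> \<Longrightarrow> g x \<in> M.closed_orthant \<tau>"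
    and into_back: "\<And>x. x \<in> M.closed_orthant \<tau> \<Longrightarrow> ?h x \<in> A.closed_orthant \<sigma>"
    by auto
  \<comment> \<open>\<open>g\<close> maps the closed orthant onto the closed orthant, hence extreme rays to extreme rays.\<close>
  have "\<exists>j b. g (p i) = b *\<^sub>R p' j" for i
  proof -
    have "\<sigma> i *\<^sub>R p i \<in> A.closed_orthant \<sigma>"
      by (simp add: A.closed_orthant_def A.coord_scaleR A.coord_p)
    then have x: "g (\<sigma> i *\<^sub>R p i) \<in> M.closed_orthant \<tau>" by (rule into)
    let ?x = "g (\<sigma> i *\<^sub>R p i)"
    have "?h ?x \<noteq> 0" using \<sigma>(1) A.p_nonzero by (simp add: hg)
    then have "?x \<noteq> 0" using linear_0[OF h(1)] by metis
    then obtain j where j: "coord' j ?x \<noteq> 0"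
      using M.coord_eqI[of ?x 0] by (auto simp: M.coord_0)
    \<comment> \<open>\<open>y\<close> is one nonzero component of the image of
      \<open>\<sigma> i *\<^sub>R p i\<close>, and it and the remainder both lie in the closed
      orthant. Pulled back, they are two elements of the orthant with sum on an extreme ray, so both
      lie on that ray.\<close>
    define y where "y = coord' j ?x *\<^sub>R p' j"
    have "y \<in> M.closed_orthant \<tau>" "?x - y \<in> M.closed_orthant \<tau>"
      using x by (auto simp: y_def M.closed_orthant_def M.coord_scaleR M.coord_diff M.coord_p)
    then have pos: "?h y \<in> A.closed_orthant \<sigma>" "?h (?x - y) \<in> A.closed_orthant \<sigma>"
      by (auto intro: into_back)
    have "coord k (?h y) = 0" if "k \<noteq> i" for k
    proof -
      have "\<sigma> k * coord k (?h y) + \<sigma> k * coord k (?h (?x - y)) = \<sigma> k * coord k (\<sigma> i *\<^sub>R p i)"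
        by (simp add: linear_diff[OF h(1)] A.coord_diff hg algebra_simps)
      also have "\<dots> = 0" using that by (simp add: A.coord_scaleR A.coord_p)
      finally have "\<sigma> k * coord k (?h y) = 0"
        using pos by (simp add: A.closed_orthant_def add_nonneg_eq_0_iff)
      then show ?thesis using \<sigma>(1) by simp
    qed
    then have "?h y = coord i (?h y) *\<^sub>R p i"
      by (intro A.coord_eqI) (simp add: A.coord_scaleR A.coord_p)
    then have "g (?h y) = coord i (?h y) *\<^sub>R g (p i)" using linear_cmul[OF g(1)] by metis
    then have eq: "coord i (?h y) *\<^sub>R g (p i) = coord' j ?x *\<^sub>R p' j"
      by (simp add: gh y_def)
    then have "coord i (?h y) \<noteq> 0" using j M.p_nonzero by auto
    then have "g (p i) = inverse (coord i (?h y)) *\<^sub>R (coord i (?h y) *\<^sub>R g (p i))"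
      by simp
    then have "g (p i) = (inverse (coord i (?h y)) * coord' j ?x) *\<^sub>R p' j"
      unfolding eq scaleR_scaleR .
    then show ?thesis by blast
  qed
  then show thesis using that g by blast
qed

section \<open>The discriminant as an invariant, up to integer squares\<close>

text \<open>For a root c, the vector (1, c, c^2) is an eigenvector. The Vandermonde determinant of
  three distinct roots is nonzero, so these vectors form a basis, and the inverse Vandermonde matrix
  gives the coordinates.\<close>

lemma frobenius_eigenframe:
  fixes t s d :: int
  assumes "cubic_disc (t, s, d) > 0"
  obtains c :: "3 \<Rightarrow> real" and coord where
    "eigenframe (frobenius_matrix t (- s) d) (\<lambda>i. vector [1, c i, (c i)^2]) c coord"
    "of_int t = c 1 + c 2 + c 3" "of_int s = c 1 * c 2 + c 1 * c 3 + c 2 * c 3"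
    "of_int d = c 1 * c 2 * c 3"
proof -
  have "cubic_disc (real_of_int t, real_of_int s, real_of_int d) > 0"
    using assms by (simp add: of_int_cubic_disc)
  then obtain r1 r2 r3 :: real where r: "distinct [r1, r2, r3]"
    and V: "real_of_int t = r1 + r2 + r3" "real_of_int s = r1 * r2 + r1 * r3 + r2 * r3"
      "real_of_int d = r1 * r2 * r3"
    by (rule cubic_three_real_roots)
  define c :: "3 \<Rightarrow> real" where "c i = (vector [r1, r2, r3] :: real ^ 3) $ i" for i
  have c: "c 1 = r1" "c 2 = r2" "c 3 = r3" by (simp_all add: c_def)
  define p where "p i = (vector [1, c i, (c i)^2] :: real ^ 3)" for i
  define P where "P = (\<chi> i j. p j $ i)"
  have column: "column j P = p j" for j
    by (simp add: column_def P_def)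
  have "det P = (r2 - r1) * (r3 - r1) * (r3 - r2)"
    by (simp add: det_3 P_def p_def c algebra_simps power2_eq_square)
  then have "invertible P" using r by (simp add: invertible_det_nz)
  then obtain Q where PQ: "P ** Q = mat 1" and QP: "Q ** P = mat 1"
    unfolding invertible_def by blast
  define coord where "coord i x = (Q *v x) $ i" for i x
  have "eigenframe (frobenius_matrix t (- s) d) p c coord"
  proof (rule eigenframe.intro)
    show "linear (coord i)" for i
      unfolding coord_def
      by (intro linearI) (simp_all add: matrix_vector_right_distrib matrix_vector_mult_scaleR)
    show "(\<Sum>i\<in>UNIV. coord i x *\<^sub>R p i) = x" for x
      using matrix_mult_sum[of P "Q *v x"]
      by (simp add: coord_def column scalar_mult_eq_scaleR matrix_vector_mul_assoc PQ)
    show "coord i (p j) = (if i = j then 1 else 0)" for i j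
    proof -
      have "p j = P *v axis j 1" by (simp add: matrix_vector_mult_basis column)
      then have "coord i (p j) = (axis j 1 :: real ^ 3) $ i"
        by (simp add: coord_def matrix_vector_mul_assoc QP)
      then show ?thesis by (simp add: axis_def)
    qed
    show "map_matrix real_of_int (frobenius_matrix t (- s) d) *v p i = c i *\<^sub>R p i" for i
      using exhaust_3[of i]
      by (auto simp: vec_eq_iff forall_3 frobenius_matrix_def map_matrix_def matrix_vector_mult_def sum_3
          p_def c V algebra_simps power2_eq_square)
    show "inj c"
      using r by (auto simp: inj_def forall_3 c)
  qed
  moreover have "p = (\<lambda>i. vector [1, c i, (c i)^2])" by (simp add: p_def fun_eq_iff)
  ultimately show thesis
    using that[of c coord] V by (simp add: c)
qed

lemma lattice_automorphism_matrix:
  fixes g :: "real ^ 'n \<Rightarrow> real ^ 'n"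
  assumes "linear g" "g ` integer_lattice \<subseteq> integer_lattice"
  obtains X :: "int ^ 'n ^ 'n" where "\<And>v. g v = map_matrix real_of_int X *v v"
proof
  \<comment> \<open>The columns are images of unit vectors, hence integral, so taking floors only
    changes the type.\<close>
  let ?X = "(\<chi> i j. \<lfloor>matrix g $ i $ j\<rfloor>) :: int ^ 'n ^ 'n"
  have "matrix g $ i $ j \<in> \<int>" for i j
  proof -
    have "g (axis j 1) \<in> integer_lattice" using assms(2) axis_in_integer_lattice by blast
    then show ?thesis by (simp add: matrix_def integer_lattice_def)
  qed
  then have "map_matrix real_of_int ?X = matrix g"
    by (simp add: vec_eq_iff map_matrix_def)
  then show "g v = map_matrix real_of_int ?X *v v" for v
    using assms(1) by simp
qed

text \<open>Each difference f x - f y contains x - y with cofactor q1 + q2 (x + y). The product of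
  the three cofactors is symmetric in the roots; it is the index form of the cubic, and its square
  is the factor gained.\<close>

lemma cubic_disc_quadratic_transform:
  fixes a b c q0 q1 q2 :: "'a::comm_ring_1"
  defines "t \<equiv> a + b + c" and "s \<equiv> a * b + a * c + b * c" and "d \<equiv> a * b * c"
    and "f \<equiv> (\<lambda>x. q0 + q1 * x + q2 * x^2)"
  shows "cubic_disc (f a + f b + f c, f a * f b + f a * f c + f b * f c, f a * f b * f c)
    = ((q1 + q2 * t)^3 - (q1 + q2 * t)^2 * q2 * t + (q1 + q2 * t) * q2^2 * s - q2^3 * d)^2
      * cubic_disc (t, s, d)"
proof -
  have diff: "f x - f y = (x - y) * (q1 + q2 * (x + y))" for x y
    by (simp add: f_def algebra_simps power2_eq_square)
  have index: "(q1 + q2 * (a + b)) * (q1 + q2 * (a + c)) * (q1 + q2 * (b + c))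
    = (q1 + q2 * t)^3 - (q1 + q2 * t)^2 * q2 * t + (q1 + q2 * t) * q2^2 * s - q2^3 * d"
    by (simp add: t_def s_def d_def algebra_simps power2_eq_square power3_eq_cube)
  have "cubic_disc (t, s, d) = ((a - b) * (a - c) * (b - c))^2"
    unfolding t_def s_def d_def by (rule cubic_disc_roots)
  then show ?thesis
    unfolding cubic_disc_roots diff index[symmetric]
    by (simp only: power_mult_distrib mult_ac)
qed

text \<open>Conjugating the second matrix back by \<open>g\<close> gives an integer matrix
  \<open>N\<close> with the eigenlines of the first. Its eigenvalues are thus an integer quadratic
  in those of the first matrix, and the transformation law of the discriminant applies.\<close>

lemma cf_equivalent_frobenius_disc:
  assumes D: "cubic_disc (t, s, d) > 0" and D': "cubic_disc (t', s', d') > 0"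
    and equiv: "cf_equivalent (continued_fraction (frobenius_matrix t (- s) d))
      (continued_fraction (frobenius_matrix t' (- s') d'))"
  obtains m :: int where "cubic_disc (t', s', d') = m^2 * cubic_disc (t, s, d)"
proof -
  let ?F = "frobenius_matrix t (- s) d" and ?M = "frobenius_matrix t' (- s') d'"
  let ?r = "map_matrix real_of_int :: int ^ 3 ^ 3 \<Rightarrow> real ^ 3 ^ 3"
  obtain c coord where F: "eigenframe ?F (\<lambda>i. vector [1, c i, (c i)^2]) c coord"
    and V: "real_of_int t = c 1 + c 2 + c 3" "real_of_int s = c 1 * c 2 + c 1 * c 3 + c 2 * c 3"
      "real_of_int d = c 1 * c 2 * c 3"
    using D by (rule frobenius_eigenframe)
  obtain c' coord' where M: "eigenframe ?M (\<lambda>i. vector [1, c' i, (c' i)^2]) c' coord'"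
    and V': "real_of_int t' = c' 1 + c' 2 + c' 3" "real_of_int s' = c' 1 * c' 2 + c' 1 * c' 3 + c' 2 * c' 3"
      "real_of_int d' = c' 1 * c' 2 * c' 3"
    using D' by (rule frobenius_eigenframe)
  interpret F: eigenframe ?F "\<lambda>i. vector [1, c i, (c i)^2]" c coord by (rule F)
  interpret M: eigenframe ?M "\<lambda>i. vector [1, c' i, (c' i)^2]" c' coord' by (rule M)
  define p :: "3 \<Rightarrow> real ^ 3" where "p i = vector [1, c i, (c i)^2]" for i
  define p' :: "3 \<Rightarrow> real ^ 3" where "p' i = vector [1, c' i, (c' i)^2]" for i
  obtain g where g: "linear g" "g ` integer_lattice = integer_lattice"
    and ex: "\<And>i. \<exists>j b. g (p i) = b *\<^sub>R p' j"
    unfolding p_def p'_def using cf_equivalent_eigenframes[OF F M equiv] by metis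
  have bij: "bij g" using g by (rule bij_of_lattice_automorphism)
  obtain j b where jb: "\<And>i. g (p i) = b i *\<^sub>R p' (j i)" using ex by metis
  have hg: "inv g (g x) = x" for x using bij by (simp add: bij_is_inj)
  have "linear (inv g)" using linear_inv_bij[OF g(1) bij] .
  obtain X where X: "\<And>v. g v = ?r X *v v"
    using lattice_automorphism_matrix[OF g(1)] g(2) by (metis order_refl)
  obtain Y where Y: "\<And>v. inv g v = ?r Y *v v"
    using lattice_automorphism_matrix[OF \<open>linear (inv g)\<close>] inv_lattice[OF bij g(2)]
    by (metis order_refl)
  define N where "N = Y ** (?M ** X)"
  \<comment> \<open>The eigenvector (1, c, c^2) has first entry 1, so the first row of
    \<open>N\<close> applied to it is the eigenvalue, a quadratic in c with integer
    coefficients.\<close>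
  define q where "q x = of_int (N $ 1 $ 1) + of_int (N $ 1 $ 2) * x + of_int (N $ 1 $ 3) * x^2" for x :: real
  have conj: "q (c i) = c' (j i)" for i
  proof -
    have "?r N *v p i = inv g (?r ?M *v g (p i))"
      by (simp add: N_def map_matrix_of_int_mult X Y flip: matrix_vector_mul_assoc)
    also have "?r ?M *v g (p i) = c' (j i) *\<^sub>R g (p i)"
      using M.eigen[of "j i"] by (simp add: jb p'_def matrix_vector_mult_scaleR mult.commute)
    also have "inv g \<dots> = c' (j i) *\<^sub>R p i"
      by (simp add: linear_cmul[OF \<open>linear (inv g)\<close>] hg)
    finally have "(?r N *v p i) $ 1 = (c' (j i) *\<^sub>R p i) $ 1" by simp
    then show ?thesis
      by (simp add: q_def p_def matrix_vector_mult_def map_matrix_def sum_3)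
  qed
  \<comment> \<open>Distinct eigenlines have distinct images, so the values of \<open>q\<close> are
    all three roots of the second cubic and Vieta applies to them.\<close>
  have "inj j"
  proof (rule injI, rule ccontr)
    fix i k assume ik: "j i = j k" "i \<noteq> k"
    have nz: "b k \<noteq> 0"
    proof
      assume "b k = 0"
      then have "inv g (g (p k)) = 0" using linear_0[OF \<open>linear (inv g)\<close>] by (simp add: jb)
      then show False using F.p_nonzero[of k] by (simp add: hg p_def)
    qed
    have "g (b k *\<^sub>R p i) = g (b i *\<^sub>R p k)"
      using ik(1) by (simp add: linear_cmul[OF g(1)] jb)
    then have "b k *\<^sub>R p i = b i *\<^sub>R p k" using bij by (simp add: bij_is_inj inj_eq)
    then have "coord i (b k *\<^sub>R p i) = coord i (b i *\<^sub>R p k)" by simp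
    then show False
      using nz ik(2) F.coord_p[of i i] F.coord_p[of i k] by (simp add: F.coord_scaleR p_def)
  qed
  then have dist: "distinct [q (c 1), q (c 2), q (c 3)]"
    using M.inj_c by (simp add: conj inj_eq)
  have root: "x^3 - of_int t' * x^2 + of_int s' * x - of_int d' = 0" if x_in: "x \<in> {q (c 1), q (c 2), q (c 3)}" for x :: real
  proof -
    obtain i where x: "x = c' i" using x_in conj by (metis insertE singletonD)
    have "(x - c' 1) * (x - c' 2) * (x - c' 3) = 0"
      using exhaust_3[of i] x by auto
    then show ?thesis unfolding V' by (simp add: algebra_simps power2_eq_square power3_eq_cube)
  qed
  define q0 q1 q2 where "q0 = N $ 1 $ 1" and "q1 = N $ 1 $ 2" and "q2 = N $ 1 $ 3"
  define m where "m = (q1 + q2 * t)^3 - (q1 + q2 * t)^2 * q2 * t + (q1 + q2 * t) * q2^2 * s - q2^3 * d"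
  have "real_of_int (cubic_disc (t', s', d')) = cubic_disc (real_of_int t', real_of_int s', real_of_int d')"
    by (simp add: of_int_cubic_disc)
  also have "\<dots> = cubic_disc (q (c 1) + q (c 2) + q (c 3),
      q (c 1) * q (c 2) + q (c 1) * q (c 3) + q (c 2) * q (c 3), q (c 1) * q (c 2) * q (c 3))"
    using cubic_Vieta[OF dist, of "of_int t'" "of_int s'" "of_int d'"] root by simp
  also have "\<dots> = (of_int m)^2 * cubic_disc (real_of_int t, real_of_int s, real_of_int d)"
    unfolding q_def q0_def[symmetric] q1_def[symmetric] q2_def[symmetric] cubic_disc_quadratic_transform
      V[symmetric] by (simp add: m_def)
  also have "\<dots> = of_int (m^2 * cubic_disc (t, s, d))"
    by (simp add: of_int_cubic_disc)
  finally have "cubic_disc (t', s', d') = m^2 * cubic_disc (t, s, d)"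
    by (simp only: of_int_eq_iff)
  then show thesis by (rule that)
qed

section \<open>Conjugation to Frobenius matrices\<close>

lemma frobenius_matrix_mat3: "frobenius_matrix a1 a2 a3 = mat3 ((0, 1, 0), (0, 0, 1), (a3, a2, a1))"
  by (simp add: frobenius_matrix_def mat3_def)

lemma mat_mat3: "mat k = mat3 ((k, 0, 0), (0, k, 0), (0, 0, k))"
  by (simp add: mat3_def vec_eq_iff forall_3 mat_def)

lemma mat3_add: "mat3 ((x, b, c), (d, y, e), (f, g, z)) + mat3 ((x', b', c'), (d', y', e'), (f', g', z'))
    = mat3 ((x + x', b + b', c + c'), (d + d', y + y', e + e'), (f + f', g + g', z + z'))"
  by (simp add: mat3_def vec_eq_iff forall_3)

lemma mat3_mult: "mat3 ((x, b, c), (d, y, e), (f, g, z)) ** mat3 ((x', b', c'), (d', y', e'), (f', g', z'))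
    = mat3 ((x * x' + b * d' + c * f', x * b' + b * y' + c * g', x * c' + b * e' + c * z'),
        (d * x' + y * d' + e * f', d * b' + y * y' + e * g', d * c' + y * e' + e * z'),
        (f * x' + g * d' + z * f', f * b' + g * y' + z * g', f * c' + g * e' + z * z'))"
  by (simp add: mat3_def vec_eq_iff forall_3 matrix_matrix_mult_def sum_3)

lemmas mat3_simps = frobenius_matrix_mat3 mat_mat3 mat3_add mat3_mult

lemma mat3_unimodular_inverse:
  assumes "char_coeffs T = (t, s, D)" "\<bar>D\<bar> = 1"
  obtains Y where "mat3 T ** Y = mat 1" "Y ** mat3 T = mat 1"
proof -
  obtain x b c d y e f g z where T: "T = ((x, b, c), (d, y, e), (f, g, z))"
    by (metis prod.exhaust)
  have D: "D = x * (y * z - e * g) + b * (e * f - d * z) + c * (d * g - y * f)"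
    using assms(1) by (simp add: T char_coeffs.simps)
  have D2: "D * D = 1" using assms(2) by (metis abs_mult_self_eq mult_1)
  \<comment> \<open>The inverse is the adjugate divided by the determinant, and 1 / D = D for D = 1
    or D = -1.\<close>
  let ?Y = "mat3 ((D * (y * z - e * g), D * (c * g - b * z), D * (b * e - c * y)),
    (D * (e * f - d * z), D * (x * z - c * f), D * (c * d - x * e)),
    (D * (d * g - y * f), D * (b * f - x * g), D * (x * y - b * d)))"
  have "mat3 T ** ?Y = mat (D * D)" "?Y ** mat3 T = mat (D * D)"
    unfolding T mat3_mult mat_mat3 by (simp_all add: D algebra_simps)
  then show thesis using that D2 by simp
qed

text \<open>An integer row vector \<open>v = (i, j, k)\<close> for which \<open>v\<close>, \<open>vA\<close>, \<open>vA\<^sup>2\<close> is a lattice basis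
  conjugates \<open>A\<close> to the Frobenius matrix of its characteristic polynomial.\<close>

lemma cf_equivalent_frobenius_cyclic:
  assumes T: "T = ((x, b, c), (d, y, e), (f, g, z))" "char_coeffs T = (t, s, D)"
    and w: "(w1, w2, w3) = (i * x + j * d + k * f, i * b + j * y + k * g, i * c + j * e + k * z)"
    and u: "(u1, u2, u3) = (w1 * x + w2 * d + w3 * f, w1 * b + w2 * y + w3 * g, w1 * c + w2 * e + w3 * z)"
    and unit: "\<bar>i * (w2 * u3 - w3 * u2) + j * (w3 * u1 - w1 * u3) + k * (w1 * u2 - w2 * u1)\<bar> = 1"
  shows "cf_equivalent (continued_fraction (mat3 T)) (continued_fraction (frobenius_matrix t (- s) D))"
proof -
  let ?X = "mat3 ((i, j, k), (w1, w2, w3), (u1, u2, u3))"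
  let ?F = "frobenius_matrix t (- s) D"
  obtain Y where Y: "?X ** Y = mat 1" "Y ** ?X = mat 1"
    using mat3_unimodular_inverse[of "((i, j, k), (w1, w2, w3), (u1, u2, u3))"] unit
    by (auto simp: char_coeffs.simps)
  have tsD: "t = x + y + z" "s = x * y + x * z + y * z - b * d - c * f - e * g"
    "D = x * (y * z - e * g) + b * (e * f - d * z) + c * (d * g - y * f)"
    using T(2) by (simp_all add: T(1) char_coeffs.simps)
  have w': "w1 = i * x + j * d + k * f" "w2 = i * b + j * y + k * g" "w3 = i * c + j * e + k * z"
    and u': "u1 = w1 * x + w2 * d + w3 * f" "u2 = w1 * b + w2 * y + w3 * g" "u3 = w1 * c + w2 * e + w3 * z"
    using w u by simp_all
  \<comment> \<open>Cayley-Hamilton applied to the row vector: v A^3 = D v - s v A + t v A^2. This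
    is the last row of the intertwining relation.\<close>
  have "u1 * x + u2 * d + u3 * f = D * i - s * w1 + t * u1"
    "u1 * b + u2 * y + u3 * g = D * j - s * w2 + t * u2"
    "u1 * c + u2 * e + u3 * z = D * k - s * w3 + t * u3"
    unfolding u' w' tsD by (simp_all add: algebra_simps)
  then have XA: "?X ** mat3 T = ?F ** ?X"
    unfolding T(1) frobenius_matrix_mat3 mat3_mult by (simp add: w' u')
  have id: "matrix_quadratic (0, 1, 0) M = M" for M :: "int ^ 3 ^ 3"
    by (simp add: vec_eq_iff matrix_matrix_mult_def mat_def if_distrib[of "\<lambda>a. a * _"] cong: if_cong)
  show ?thesis
    by (rule cf_equivalent_intertwiner[OF Y, where q = "(0, 1, 0)" and r = "(0, 1, 0)"])
      (simp_all only: id XA)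
qed

lemma cyclic_unit_vector_imp_equivalent:
  assumes cyc: "cyclic_unit_vector T" and T: "char_coeffs T = (t, s, D)"
  shows "cf_equivalent (continued_fraction (mat3 T)) (continued_fraction (frobenius_matrix t (- s) D))"
proof -
  obtain x b c d y e f g z where T': "T = ((x, b, c), (d, y, e), (f, g, z))"
    by (metis prod.exhaust)
  consider "\<bar>b * (b * e + c * (z - y)) - c * c * g\<bar> = 1"
    | "\<bar>e * (d * (x - z) + e * f) - d * d * c\<bar> = 1"
    | "\<bar>f * (f * b + g * (y - x)) - g * g * d\<bar> = 1"
    using cyc by (auto simp: T' cyclic_unit_vector_def)
  then show ?thesis
  proof cases
    case 1
    then show ?thesis
      by (intro cf_equivalent_frobenius_cyclic[OF T' T, where i = 1 and j = 0 and k = 0, OF refl refl])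
        (simp add: algebra_simps)
  next
    case 2
    then show ?thesis
      by (intro cf_equivalent_frobenius_cyclic[OF T' T, where i = 0 and j = 1 and k = 0, OF refl refl])
        (simp add: algebra_simps)
  next
    case 3
    then show ?thesis
      by (intro cf_equivalent_frobenius_cyclic[OF T' T, where i = 0 and j = 0 and k = 1, OF refl refl])
        (simp add: algebra_simps)
  qed
qed

lemma cf_equivalent_refl: "cf_equivalent F F"
  unfolding cf_equivalent_def by (intro exI[of _ id]) (simp add: linear_id)

text \<open>The rows of \<open>X\<close> are \<open>e\<close>, \<open>eN\<close>, \<open>eN\<^sup>2\<close>, where \<open>e\<close> is the first unit vector and \<open>N\<close> the
  polynomial with coefficients \<open>q\<close> in the given Frobenius matrix, chosen to have the
  characteristic cubic of the target.\<close>

lemma frobenius_standard: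
  "cf_equivalent (continued_fraction (frobenius_matrix (-3) 0 1))
     (continued_fraction (frobenius_matrix 0 3 1))"
  "cf_equivalent (continued_fraction (frobenius_matrix (-2) 1 1))
     (continued_fraction (frobenius_matrix (-1) 2 1))"
  "cf_equivalent (continued_fraction (frobenius_matrix (-2) 2 2))
     (continued_fraction (frobenius_matrix (-1) 3 1))"
  "cf_equivalent (continued_fraction (frobenius_matrix 0 3 (-1)))
     (continued_fraction (frobenius_matrix 0 3 1))"
  "cf_equivalent (continued_fraction (frobenius_matrix 1 2 (-1)))
     (continued_fraction (frobenius_matrix (-1) 2 1))"
  "cf_equivalent (continued_fraction (frobenius_matrix 0 4 (-2)))
     (continued_fraction (frobenius_matrix (-1) 3 1))"
  "cf_equivalent (continued_fraction (frobenius_matrix 0 4 2))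
     (continued_fraction (frobenius_matrix (-1) 3 1))"
  "cf_equivalent (continued_fraction (frobenius_matrix 1 3 (-1)))
     (continued_fraction (frobenius_matrix (-1) 3 1))"
  "cf_equivalent (continued_fraction (frobenius_matrix 2 2 (-2)))
     (continued_fraction (frobenius_matrix (-1) 3 1))"
  "cf_equivalent (continued_fraction (frobenius_matrix 2 1 (-1)))
     (continued_fraction (frobenius_matrix (-1) 2 1))"
  "cf_equivalent (continued_fraction (frobenius_matrix 3 0 (-1)))
     (continued_fraction (frobenius_matrix 0 3 1))"
proof -
  \<comment> \<open>In the first three cases the substitution x -> -1 - x relates the cubics; it is
    an involution, so \<open>q\<close> = \<open>r\<close> and \<open>X\<close> is its own
    inverse.\<close>
  show "cf_equivalent (continued_fraction (frobenius_matrix (-3) 0 1))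
      (continued_fraction (frobenius_matrix 0 3 1))"
    by (rule cf_equivalent_intertwiner[where q = "(-1, -1, 0)" and r = "(-1, -1, 0)"
        and X = "mat3 ((1, 0, 0), (-1, -1, 0), (1, 2, 1))" and Y = "mat3 ((1, 0, 0), (-1, -1, 0), (1, 2, 1))"];
      simp add: mat3_simps)+
  show "cf_equivalent (continued_fraction (frobenius_matrix (-2) 1 1))
      (continued_fraction (frobenius_matrix (-1) 2 1))"
    by (rule cf_equivalent_intertwiner[where q = "(-1, -1, 0)" and r = "(-1, -1, 0)"
        and X = "mat3 ((1, 0, 0), (-1, -1, 0), (1, 2, 1))" and Y = "mat3 ((1, 0, 0), (-1, -1, 0), (1, 2, 1))"];
      simp add: mat3_simps)+
  show "cf_equivalent (continued_fraction (frobenius_matrix (-2) 2 2))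
      (continued_fraction (frobenius_matrix (-1) 3 1))"
    by (rule cf_equivalent_intertwiner[where q = "(-1, -1, 0)" and r = "(-1, -1, 0)"
        and X = "mat3 ((1, 0, 0), (-1, -1, 0), (1, 2, 1))" and Y = "mat3 ((1, 0, 0), (-1, -1, 0), (1, 2, 1))"];
      simp add: mat3_simps)+
  \<comment> \<open>Here the roots are merely negated.\<close>
  show "cf_equivalent (continued_fraction (frobenius_matrix 0 3 (-1)))
      (continued_fraction (frobenius_matrix 0 3 1))"
    by (rule cf_equivalent_intertwiner[where q = "(0, -1, 0)" and r = "(0, -1, 0)"
        and X = "mat3 ((1, 0, 0), (0, -1, 0), (0, 0, 1))" and Y = "mat3 ((1, 0, 0), (0, -1, 0), (0, 0, 1))"];
      simp add: mat3_simps)+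
  show "cf_equivalent (continued_fraction (frobenius_matrix 1 2 (-1)))
      (continued_fraction (frobenius_matrix (-1) 2 1))"
    by (rule cf_equivalent_intertwiner[where q = "(0, -1, 0)" and r = "(0, -1, 0)"
        and X = "mat3 ((1, 0, 0), (0, -1, 0), (0, 0, 1))" and Y = "mat3 ((1, 0, 0), (0, -1, 0), (0, 0, 1))"];
      simp add: mat3_simps)+
  \<comment> \<open>The traces 0 and -1 cannot be matched by a substitution x -> x + k or x -> k - x
    with k an integer, so a genuine quadratic is used in this case and the next; \<open>r\<close>
    inverts \<open>q\<close> on the roots.\<close>
  show "cf_equivalent (continued_fraction (frobenius_matrix 0 4 (-2)))
      (continued_fraction (frobenius_matrix (-1) 3 1))"
    by (rule cf_equivalent_intertwiner[where q = "(-3, 1, 1)" and r = "(-2, 1, 1)"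
        and X = "mat3 ((1, 0, 0), (-3, 1, 1), (5, 0, -1))" and Y = "mat3 ((1, 0, 0), (-2, 1, 1), (5, 0, -1))"];
      simp add: mat3_simps)+
  show "cf_equivalent (continued_fraction (frobenius_matrix 0 4 2))
      (continued_fraction (frobenius_matrix (-1) 3 1))"
    by (rule cf_equivalent_intertwiner[where q = "(-3, -1, 1)" and r = "(2, -1, -1)"
        and X = "mat3 ((1, 0, 0), (-3, -1, 1), (5, 0, -1))" and Y = "mat3 ((1, 0, 0), (2, -1, -1), (5, 0, -1))"];
      simp add: mat3_simps)+
  show "cf_equivalent (continued_fraction (frobenius_matrix 1 3 (-1)))
      (continued_fraction (frobenius_matrix (-1) 3 1))"
    by (rule cf_equivalent_intertwiner[where q = "(0, -1, 0)" and r = "(0, -1, 0)"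
        and X = "mat3 ((1, 0, 0), (0, -1, 0), (0, 0, 1))" and Y = "mat3 ((1, 0, 0), (0, -1, 0), (0, 0, 1))"];
      simp add: mat3_simps)+
  \<comment> \<open>The last three cases shift the roots by -1, and \<open>r\<close> shifts them
    back.\<close>
  show "cf_equivalent (continued_fraction (frobenius_matrix 2 2 (-2)))
      (continued_fraction (frobenius_matrix (-1) 3 1))"
    by (rule cf_equivalent_intertwiner[where q = "(-1, 1, 0)" and r = "(1, 1, 0)"
        and X = "mat3 ((1, 0, 0), (-1, 1, 0), (1, -2, 1))" and Y = "mat3 ((1, 0, 0), (1, 1, 0), (1, 2, 1))"];
      simp add: mat3_simps)+
  show "cf_equivalent (continued_fraction (frobenius_matrix 2 1 (-1)))
      (continued_fraction (frobenius_matrix (-1) 2 1))"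
    by (rule cf_equivalent_intertwiner[where q = "(-1, 1, 0)" and r = "(1, 1, 0)"
        and X = "mat3 ((1, 0, 0), (-1, 1, 0), (1, -2, 1))" and Y = "mat3 ((1, 0, 0), (1, 1, 0), (1, 2, 1))"];
      simp add: mat3_simps)+
  show "cf_equivalent (continued_fraction (frobenius_matrix 3 0 (-1)))
      (continued_fraction (frobenius_matrix 0 3 1))"
    by (rule cf_equivalent_intertwiner[where q = "(-1, 1, 0)" and r = "(1, 1, 0)"
        and X = "mat3 ((1, 0, 0), (-1, 1, 0), (1, -2, 1))" and Y = "mat3 ((1, 0, 0), (1, 1, 0), (1, 2, 1))"];
      simp add: mat3_simps)+
qed

section \<open>Classification by discriminant and the counts\<close>

text \<open>The representative of each discriminant; the final branch stands for 148.\<close>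

fun disc_frobenius :: "int \<Rightarrow> int ^ 3 ^ 3" where
  "disc_frobenius D = (if D = 49 then frobenius_matrix (-1) 2 1
     else if D = 81 then frobenius_matrix 0 3 1 else frobenius_matrix (-1) 3 1)"

declare disc_frobenius.simps [simp del]

lemma standard_coeffs_cases:
  assumes "is_standard (t, s, d)"
  shows "cubic_disc (t, s, d) \<in> {49, 81, 148} \<and>
    cf_equivalent (continued_fraction (frobenius_matrix t (- s) d))
      (continued_fraction (disc_frobenius (cubic_disc (t, s, d))))"
  using assms unfolding is_standard_def standard_coeffs_def
  by (auto simp: cubic_disc.simps disc_frobenius.simps cf_equivalent_refl frobenius_standard)

text \<open>Equivalence is symmetric, so each discriminant is an integer square times the other.
  They divide each other, and no two of 49, 81 and 148 do so.\<close>

lemma not_cf_equivalent_disc_frobenius: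
  assumes "D \<in> {49, 81, 148}" "D' \<in> {49, 81, 148}"
    and "cf_equivalent (continued_fraction (disc_frobenius D)) (continued_fraction (disc_frobenius D'))"
  shows "D = D'"
proof (rule ccontr)
  assume "D \<noteq> D'"
  moreover have dvd: "D dvd D'"
    if D: "D \<in> {49, 81, 148}" "D' \<in> {49, 81, 148}"
      and equiv: "cf_equivalent (continued_fraction (disc_frobenius D)) (continued_fraction (disc_frobenius D'))"
    for D D'
  proof -
    have ex: "\<exists>t s d. disc_frobenius E = frobenius_matrix t (- s) d \<and> cubic_disc (t, s, d) = E"
      if "E \<in> {49, 81, 148}" for E
    proof -
      have "disc_frobenius 49 = frobenius_matrix (-1) (- (-2)) 1 \<and> cubic_disc (-1, -2, 1) = (49 :: int)"
        "disc_frobenius 81 = frobenius_matrix 0 (- (-3)) 1 \<and> cubic_disc (0, -3, 1) = (81 :: int)"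
        "disc_frobenius 148 = frobenius_matrix (-1) (- (-3)) 1 \<and> cubic_disc (-1, -3, 1) = (148 :: int)"
        by (simp_all add: disc_frobenius.simps cubic_disc.simps)
      then show ?thesis using that by blast
    qed
    obtain t s d t' s' d' where F: "disc_frobenius D = frobenius_matrix t (- s) d" "cubic_disc (t, s, d) = D"
      and M: "disc_frobenius D' = frobenius_matrix t' (- s') d'" "cubic_disc (t', s', d') = D'"
      using ex[OF D(1)] ex[OF D(2)] by blast
    have "cubic_disc (t, s, d) > 0" "cubic_disc (t', s', d') > 0" using D F(2) M(2) by auto
    then obtain m where "cubic_disc (t', s', d') = m^2 * cubic_disc (t, s, d)"
      using equiv unfolding F(1) M(1) by (rule cf_equivalent_frobenius_disc)
    then show ?thesis by (simp add: F(2) M(2))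
  qed
  have "D dvd D'" "D' dvd D"
    using dvd assms cf_equivalent_sym by blast+
  ultimately show False using assms(1,2) by auto
qed

lemma hyperbolic_list_classified:
  assumes census: "census n = (k, k49, k81, k148, True)" and T: "T \<in> set (hyperbolic_list n)"
  shows "cubic_disc (char_coeffs T) \<in> {49, 81, 148}"
    and "cf_equivalent (continued_fraction (mat3 T))
      (continued_fraction (disc_frobenius (cubic_disc (char_coeffs T))))"
proof -
  obtain t s d where C: "char_coeffs T = (t, s, d)" by (metis prod.exhaust)
  have "cyclic_unit_vector T" "is_standard (t, s, d)"
    using census T by (auto simp: census_def Let_def list_all_iff simp flip: C)
  then show "cubic_disc (char_coeffs T) \<in> {49, 81, 148}"
    and "cf_equivalent (continued_fraction (mat3 T))
      (continued_fraction (disc_frobenius (cubic_disc (char_coeffs T))))"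
    using standard_coeffs_cases cyclic_unit_vector_imp_equivalent[OF _ C] cf_equivalent_trans
    unfolding C by blast+
qed

text \<open>The matrix is equivalent to the representative of its own discriminant; equivalence to
  another would identify two of the representatives.\<close>

lemma cf_equivalent_disc_frobenius_iff:
  assumes census: "census n = (k, k49, k81, k148, True)" and T: "T \<in> set (hyperbolic_list n)"
    and D: "D \<in> {49, 81, 148}"
  shows "cf_equivalent (continued_fraction (mat3 T)) (continued_fraction (disc_frobenius D))
    \<longleftrightarrow> cubic_disc (char_coeffs T) = D"
proof
  note cl = hyperbolic_list_classified[OF census T]
  assume "cf_equivalent (continued_fraction (mat3 T)) (continued_fraction (disc_frobenius D))"
  then show "cubic_disc (char_coeffs T) = D"
    by (intro not_cf_equivalent_disc_frobenius[OF cl(1) D] cf_equivalent_trans[OF cf_equivalent_sym[OF cl(2)]])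
next
  assume "cubic_disc (char_coeffs T) = D"
  then show "cf_equivalent (continued_fraction (mat3 T)) (continued_fraction (disc_frobenius D))"
    using hyperbolic_list_classified(2)[OF census T] by simp
qed

lemma card_hyperbolic_disc:
  assumes census: "census n = (k, k49, k81, k148, True)" and D: "D \<in> {49, 81, 148}"
  shows "card {A \<in> hyperbolic_matrices. matrix_norm A = n \<and>
      cf_equivalent (continued_fraction A) (continued_fraction (disc_frobenius D))}
    = length (filter ((=) D) (map (cubic_disc \<circ> char_coeffs) (hyperbolic_list n)))"
proof -
  let ?L = "filter (\<lambda>T. D = cubic_disc (char_coeffs T)) (hyperbolic_list n)"
  have "{A \<in> hyperbolic_matrices. matrix_norm A = n \<and>
      cf_equivalent (continued_fraction A) (continued_fraction (disc_frobenius D))}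
    = {A \<in> mat3 ` set (hyperbolic_list n).
        cf_equivalent (continued_fraction A) (continued_fraction (disc_frobenius D))}"
    unfolding hyperbolic_of_norm[symmetric] by blast
  also have "\<dots> = mat3 ` set ?L"
    using cf_equivalent_disc_frobenius_iff[OF census _ D] by auto
  also have "card \<dots> = card (set ?L)"
    using bij_mat3 by (intro card_image inj_on_subset[OF bij_is_inj]) auto
  also have "\<dots> = length ?L"
    by (intro distinct_card distinct_filter distinct_hyperbolic_list)
  finally show ?thesis by (simp add: filter_map comp_def)
qed

lemma card_hyperbolic_of_norm:
  "card {A \<in> (hyperbolic_matrices :: (int ^ 3 ^ 3) set). matrix_norm A = n} = length (hyperbolic_list n)"
proof -
  have "inj_on mat3 (set (hyperbolic_list n))"
    using bij_mat3 by (intro inj_on_subset[OF bij_is_inj]) auto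
  then show ?thesis
    by (simp add: hyperbolic_of_norm card_image distinct_card[OF distinct_hyperbolic_list])
qed

lemma matrix_norm_nonneg: "matrix_norm A \<ge> 0"
  by (simp add: matrix_norm_def sum_nonneg)

theorem mainTheorem2:
  defines "H \<equiv> (hyperbolic_matrices :: (int ^ 3 ^ 3) set)"
    and "equiv_to \<equiv> (\<lambda>A M :: int ^ 3 ^ 3.
           cf_equivalent (continued_fraction A) (continued_fraction M))"
  shows "(\<not> (\<exists>A\<in>H. matrix_norm A < 5)) \<and>
    (card {A \<in> H. matrix_norm A = 5} = 48 \<and>
     (\<forall>A\<in>H. matrix_norm A = 5 \<longrightarrow> equiv_to A (frobenius_matrix (-1) 2 1))) \<and>
    (card {A \<in> H. matrix_norm A = 6} = 912 \<and>
     (\<forall>A\<in>H. matrix_norm A = 6 \<longrightarrow>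
        equiv_to A (frobenius_matrix (-1) 2 1) \<or>
        equiv_to A (frobenius_matrix (-1) 3 1) \<or>
        equiv_to A (frobenius_matrix 0 3 1)) \<and>
     card {A \<in> H. matrix_norm A = 6 \<and> equiv_to A (frobenius_matrix (-1) 2 1)} = 480 \<and>
     card {A \<in> H. matrix_norm A = 6 \<and> equiv_to A (frobenius_matrix (-1) 3 1)} = 192 \<and>
     card {A \<in> H. matrix_norm A = 6 \<and> equiv_to A (frobenius_matrix 0 3 1)} = 240)"
proof -
  have small: "\<not> (\<exists>A\<in>H. matrix_norm A < 5)"
  proof safe
    fix A assume A: "A \<in> H" "matrix_norm A < 5"
    \<comment> \<open>Norms are nonnegative, so only the evaluated values 0 to 4 arise.\<close>
    then have "hyperbolic_list (matrix_norm A) = []"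
      using census_le_4 matrix_norm_nonneg[of A] by (simp add: list_all_iff)
    then show False using A(1) hyperbolic_of_norm[of "matrix_norm A"] unfolding H_def by auto
  qed
  have member: "\<exists>T. A = mat3 T \<and> T \<in> set (hyperbolic_list n)" if "A \<in> H" "matrix_norm A = n" for A n
    using that hyperbolic_of_norm[of n] unfolding H_def by blast
  have F: "frobenius_matrix (-1) 2 1 = disc_frobenius 49" "frobenius_matrix 0 3 1 = disc_frobenius 81"
    "frobenius_matrix (-1) 3 1 = disc_frobenius 148"
    by (simp_all add: disc_frobenius.simps)
  have five: "length (hyperbolic_list 5) = 48"
      "length (filter ((=) 49) (map (cubic_disc \<circ> char_coeffs) (hyperbolic_list 5))) = 48"
    using census_5 by (simp_all add: census_def Let_def)
  have six: "length (hyperbolic_list 6) = 912"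
      "length (filter ((=) 49) (map (cubic_disc \<circ> char_coeffs) (hyperbolic_list 6))) = 480"
      "length (filter ((=) 81) (map (cubic_disc \<circ> char_coeffs) (hyperbolic_list 6))) = 240"
      "length (filter ((=) 148) (map (cubic_disc \<circ> char_coeffs) (hyperbolic_list 6))) = 192"
    using census_6 by (simp_all add: census_def Let_def)
  have eq5: "equiv_to A (disc_frobenius 49)" if "A \<in> H" "matrix_norm A = 5" for A
  proof -
    \<comment> \<open>All 48 matrices have discriminant 49, so those equivalent to its
      representative form a subset of full cardinality.\<close>
    let ?S = "{A \<in> H. matrix_norm A = 5}" and ?E = "{A \<in> H. matrix_norm A = 5 \<and> equiv_to A (disc_frobenius 49)}"
    have "card ?S = 48" using five(1) by (simp add: H_def card_hyperbolic_of_norm)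
    moreover have "card ?E = 48"
      using card_hyperbolic_disc[OF census_5, of 49] five(2) by (simp add: H_def equiv_to_def)
    moreover have "finite ?S" unfolding H_def hyperbolic_of_norm by simp
    ultimately have "?E = ?S" by (intro card_subset_eq) auto
    then show ?thesis using that by blast
  qed
  have eq6: "equiv_to A (disc_frobenius 49) \<or> equiv_to A (disc_frobenius 148) \<or> equiv_to A (disc_frobenius 81)"
    if "A \<in> H" "matrix_norm A = 6" for A
    using member[OF that] hyperbolic_list_classified[OF census_6] unfolding equiv_to_def by fastforce
  show ?thesis
    unfolding F
    using small eq5 eq6 five(1) six
      card_hyperbolic_disc[OF census_6, of 49] card_hyperbolic_disc[OF census_6, of 81]
      card_hyperbolic_disc[OF census_6, of 148]
    by (simp add: H_def equiv_to_def card_hyperbolic_of_norm)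
qed

end
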